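(* Let $1<p\le\infty$, let $p'$ be the conjugate index of $p$ ($\frac1p+\frac1{p'}=1$), and let $X_1,\dots,X_n,Y$ be Banach spaces over the same field ($\mathbb R$ or $\mathbb C$). Then $$(X_1\hat\otimes\cdots\hat\otimes X_n\hat\otimes Y,\ d_p^{Lip})^*=\Pi_{p'}^{Lip}(X_1,\dots,X_n;Y^* )$$ isometrically, where $T\in\Pi_{p'}^{Lip}(X_1,\dots,X_n;Y^* )$ corresponds to the linear functional determined by $x_1\otimes\cdots\otimes x_n\otimes y\mapsto T(x_1,\dots,x_n)(y)$.
   Context: $\mathcal L(X_1,\dots,X_n)$ is the space of bounded scalar $n$-linear forms with the supremum norm over the product of unit balls, $B_E$ the closed unit ball of $E$. $\Sigma_{X_1,\dots,X_n}=\{x_1\otimes\cdots\otimes x_n:x_i\in X_i\}\subset X_1\otimes\cdots\otimes X_n$. Each $\varphi\in\mathcal L(X_1,\dots,X_n)$ is viewed as a function on $\Sigma_{X_1,\dots,X_n}$ via $\varphi(x_1\otimes\cdots\otimes x_n)=\varphi(x_1,\dots,x_n)$; the space of such functions is $\mathcal L(\Sigma_{X_1,\dots,X_n})$, isometric to $\mathcal L(X_1,\dots,X_n)$. For $z\in X_1\otimes\cdots\otimes X_n\otimes Y$ define $$d_p^{Lip}(z)=\inf\Big\{\sup_{\varphi\in B_{\mathcal L(\Sigma_{X_1,\dots,X_n})}}\Big(\sum_{i=1}^k|\varphi(p_i)-\varphi(q_i)|^{p'}\Big)^{1/p'}\cdot\|(\|y_i\|)_{i=1}^k\|_{\ell_p}\Big\},$$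 the infimum being over all representations $z=\sum_{i=1}^k(p_i-q_i)\otimes y_i$ with $p_i,q_i\in\Sigma_{X_1,\dots,X_n}$, $y_i\in Y$. This is a norm, and $(X_1\hat\otimes\cdots\hat\otimes X_n\hat\otimes Y,d_p^{Lip})$ denotes the completion of $X_1\otimes\cdots\otimes X_n\otimes Y$ with respect to it. For $1\le r<\infty$, a bounded $n$-linear operator $T:X_1\times\cdots\times X_n\to Z$ into a Banach space $Z$ is Lipschitz $r$-summing, $T\in\Pi_r^{Lip}(X_1,\dots,X_n;Z)$, if there is $c>0$ such that for all $k\in\mathbb N$ and all $u_1,\dots,u_k,v_1,\dots,v_k\in X_1\times\cdots\times X_n$, $$\Big(\sum_{i=1}^k\|T(u_i)-T(v_i)\|^r\Big)^{1/r}\le c\cdot\sup_{\varphi\in B_{\mathcal L(X_1,\dots,X_n)}}\Big(\sum_{i=1}^k|\varphi(u_i)-\varphi(v_i)|^r\Big)^{1/r};$$ the infimum of such $c$ is the norm $\pi_r^{Lip}(T)$. *)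

theory Defs
  imports "HOL-Analysis.Analysis"
begin

section \<open>Normed spaces over the real or complex field, with explicit carriers\<close>

text \<open>
  The spaces below (tensor products, completions, duals, spaces of operators) are not types, so a
  space is a record over a scalar type \<open>'k\<close>. The scalar field ranges over the sort
  \<open>{real_normed_field, banach}\<close>, of which \<open>real\<close> and \<open>complex\<close> are instances; by the
  Gelfand-Mazur theorem these are, up to isometric isomorphism, the only ones.
\<close>

record ('k, 'a) vspace =
  carr :: "'a set"
  vzero :: 'a
  vadd :: "'a \<Rightarrow> 'a \<Rightarrow> 'a"
  vscale :: "'k \<Rightarrow> 'a \<Rightarrow> 'a"

record ('k, 'a) nspace = "('k, 'a) vspace" +
  vnorm :: "'a \<Rightarrow> real"

definition vdiff :: "('k::{real_normed_field,banach}, 'a, 'm) vspace_scheme \<Rightarrow> 'a \<Rightarrow> 'a \<Rightarrow> 'a" where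
  "vdiff V x y = vadd V x (vscale V (- 1) y)"

primrec vsum :: "('k, 'a, 'm) vspace_scheme \<Rightarrow> (nat \<Rightarrow> 'a) \<Rightarrow> nat \<Rightarrow> 'a" where
  "vsum V f 0 = vzero V"
| "vsum V f (Suc k) = vadd V (vsum V f k) (f k)"

definition cauchy_seq :: "('k::{real_normed_field,banach}, 'a) nspace \<Rightarrow> (nat \<Rightarrow> 'a) \<Rightarrow> bool" where
  "cauchy_seq V s \<longleftrightarrow> (\<forall>n. s n \<in> carr V) \<and>
     (\<forall>e>0. \<exists>N. \<forall>m\<ge>N. \<forall>n\<ge>N. vnorm V (vdiff V (s m) (s n)) < e)"

locale normed_space =
  fixes V :: "('k::{real_normed_field,banach}, 'a) nspace"
  assumes zero_closed: "vzero V \<in> carr V"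
    and add_closed: "x \<in> carr V \<Longrightarrow> y \<in> carr V \<Longrightarrow> vadd V x y \<in> carr V"
    and scale_closed: "x \<in> carr V \<Longrightarrow> vscale V a x \<in> carr V"
    and add_assoc: "x \<in> carr V \<Longrightarrow> y \<in> carr V \<Longrightarrow> z \<in> carr V \<Longrightarrow>
          vadd V (vadd V x y) z = vadd V x (vadd V y z)"
    and add_commute: "x \<in> carr V \<Longrightarrow> y \<in> carr V \<Longrightarrow> vadd V x y = vadd V y x"
    and add_zero: "x \<in> carr V \<Longrightarrow> vadd V x (vzero V) = x"
    and diff_self: "x \<in> carr V \<Longrightarrow> vdiff V x x = vzero V"
    and scale_add_right: "x \<in> carr V \<Longrightarrow> y \<in> carr V \<Longrightarrow>
          vscale V a (vadd V x y) = vadd V (vscale V a x) (vscale V a y)"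
    and scale_add_left: "x \<in> carr V \<Longrightarrow> vscale V (a + b) x = vadd V (vscale V a x) (vscale V b x)"
    and scale_scale: "x \<in> carr V \<Longrightarrow> vscale V a (vscale V b x) = vscale V (a * b) x"
    and scale_one: "x \<in> carr V \<Longrightarrow> vscale V 1 x = x"
    and norm_nonneg: "x \<in> carr V \<Longrightarrow> 0 \<le> vnorm V x"
    and norm_eq_zero: "x \<in> carr V \<Longrightarrow> vnorm V x = 0 \<longleftrightarrow> x = vzero V"
    and norm_triangle: "x \<in> carr V \<Longrightarrow> y \<in> carr V \<Longrightarrow> vnorm V (vadd V x y) \<le> vnorm V x + vnorm V y"
    and norm_scale: "x \<in> carr V \<Longrightarrow> vnorm V (vscale V a x) = norm a * vnorm V x"

locale banach_space = normed_space +
  assumes complete: "cauchy_seq V s \<Longrightarrow>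
    \<exists>l\<in>carr V. (\<lambda>n. vnorm V (vdiff V (s n) l)) \<longlonglongrightarrow> 0"

definition unit_ball :: "('k, 'a) nspace \<Rightarrow> 'a set" where
  "unit_ball V = {x \<in> carr V. vnorm V x \<le> 1}"

definition scalars :: "('k::{real_normed_field,banach}, 'k) nspace" where
  "scalars = \<lparr>carr = UNIV, vzero = 0, vadd = (+), vscale = (*), vnorm = norm\<rparr>"

definition isometric_iso ::
    "('k, 'a) nspace \<Rightarrow> ('k, 'b) nspace \<Rightarrow> ('a \<Rightarrow> 'b) \<Rightarrow> bool" where
  "isometric_iso V W f \<longleftrightarrow> bij_betw f (carr V) (carr W) \<and>
     (\<forall>x\<in>carr V. \<forall>y\<in>carr V. f (vadd V x y) = vadd W (f x) (f y)) \<and>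
     (\<forall>a. \<forall>x\<in>carr V. f (vscale V a x) = vscale W a (f x)) \<and>
     (\<forall>x\<in>carr V. vnorm W (f x) = vnorm V x)"


section \<open>Dual and completion\<close>

definition dual :: "('k::{real_normed_field,banach}, 'a) nspace \<Rightarrow> ('k, 'a \<Rightarrow> 'k) nspace" where
  "dual V = \<lparr>
     carr = {f \<in> extensional (carr V).
       (\<forall>x\<in>carr V. \<forall>y\<in>carr V. f (vadd V x y) = f x + f y) \<and>
       (\<forall>a. \<forall>x\<in>carr V. f (vscale V a x) = a * f x) \<and>
       (\<exists>C. \<forall>x\<in>carr V. norm (f x) \<le> C * vnorm V x)},
     vzero = (\<lambda>x\<in>carr V. 0),
     vadd = (\<lambda>f g. \<lambda>x\<in>carr V. f x + g x),
     vscale = (\<lambda>a f. \<lambda>x\<in>carr V. a * f x),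
     vnorm = (\<lambda>f. SUP x\<in>unit_ball V. norm (f x))\<rparr>"

text \<open>The completion consists of the Cauchy sequences modulo the null sequences.\<close>

definition null_equiv ::
    "('k::{real_normed_field,banach}, 'a) nspace \<Rightarrow> ((nat \<Rightarrow> 'a) \<times> (nat \<Rightarrow> 'a)) set" where
  "null_equiv V = {(s, t). cauchy_seq V s \<and> cauchy_seq V t \<and>
     (\<lambda>n. vnorm V (vdiff V (s n) (t n))) \<longlonglongrightarrow> 0}"

definition cauchy_completion ::
    "('k::{real_normed_field,banach}, 'a) nspace \<Rightarrow> ('k, (nat \<Rightarrow> 'a) set) nspace" where
  "cauchy_completion V = \<lparr>
     carr = {s. cauchy_seq V s} // null_equiv V,
     vzero = null_equiv V `` {\<lambda>n. vzero V},
     vadd = (\<lambda>A B. \<Union>s\<in>A. \<Union>t\<in>B. null_equiv V `` {\<lambda>n. vadd V (s n) (t n)}),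
     vscale = (\<lambda>a A. \<Union>s\<in>A. null_equiv V `` {\<lambda>n. vscale V a (s n)}),
     vnorm = (\<lambda>A. the_elem ((\<lambda>s. lim (\<lambda>n. vnorm V (s n))) ` A))\<rparr>"

definition to_completion ::
    "('k::{real_normed_field,banach}, 'a) nspace \<Rightarrow> 'a \<Rightarrow> (nat \<Rightarrow> 'a) set" where
  "to_completion V x = null_equiv V `` {\<lambda>n. x}"


section \<open>Multilinear maps\<close>

text \<open>
  A family \<open>X\<^sub>1, \<dots>, X\<^sub>n\<close> of spaces is a function on a finite type \<open>'i\<close> with \<open>n\<close> elements
  (hence \<open>n \<ge> 1\<close>). The members share the type \<open>'a\<close> but have unrelated carriers and operations;
  spaces on different types can be carried over to a common sum type.
  \<open>snoc X Y\<close> is the family \<open>X\<^sub>1, \<dots>, X\<^sub>n, Y\<close>, and \<open>snoc x y\<close> is the tuple \<open>(x\<^sub>1, \<dots>, x\<^sub>n, y)\<close>.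
\<close>

abbreviation snoc :: "('i \<Rightarrow> 'b) \<Rightarrow> 'b \<Rightarrow> 'i option \<Rightarrow> 'b" where
  "snoc f b \<equiv> case_option b f"

definition tuples :: "('i::finite \<Rightarrow> ('k, 'a, 'm) vspace_scheme) \<Rightarrow> ('i \<Rightarrow> 'a) set" where
  "tuples X = (\<Pi> i\<in>UNIV. carr (X i))"

definition multilinear :: "('i::finite \<Rightarrow> ('k, 'a, 'm) vspace_scheme) \<Rightarrow>
    ('k, 'b, 'l) vspace_scheme \<Rightarrow> (('i \<Rightarrow> 'a) \<Rightarrow> 'b) set" where
  "multilinear X Z = {T \<in> extensional (tuples X).
     (\<forall>x\<in>tuples X. T x \<in> carr Z) \<and>
     (\<forall>x\<in>tuples X. \<forall>i. \<forall>u\<in>carr (X i). \<forall>v\<in>carr (X i).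
        T (x(i := vadd (X i) u v)) = vadd Z (T (x(i := u))) (T (x(i := v)))) \<and>
     (\<forall>x\<in>tuples X. \<forall>i. \<forall>u\<in>carr (X i). \<forall>a.
        T (x(i := vscale (X i) a u)) = vscale Z a (T (x(i := u))))}"

abbreviation forms :: "('i::finite \<Rightarrow> ('k::{real_normed_field,banach}, 'a, 'm) vspace_scheme) \<Rightarrow>
    (('i \<Rightarrow> 'a) \<Rightarrow> 'k) set" where
  "forms X \<equiv> multilinear X scalars"

definition bounded_multilinear :: "('i::finite \<Rightarrow> ('k, 'a) nspace) \<Rightarrow> ('k, 'b) nspace \<Rightarrow>
    ('k, ('i \<Rightarrow> 'a) \<Rightarrow> 'b) nspace" where
  "bounded_multilinear X Z = \<lparr>
     carr = {T \<in> multilinear X Z.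
       \<exists>C. \<forall>x\<in>tuples X. vnorm Z (T x) \<le> C * (\<Prod>i\<in>UNIV. vnorm (X i) (x i))},
     vzero = (\<lambda>x\<in>tuples X. vzero Z),
     vadd = (\<lambda>S T. \<lambda>x\<in>tuples X. vadd Z (S x) (T x)),
     vscale = (\<lambda>a T. \<lambda>x\<in>tuples X. vscale Z a (T x)),
     vnorm = (\<lambda>T. SUP x\<in>(\<Pi> i\<in>UNIV. unit_ball (X i)). vnorm Z (T x))\<rparr>"

abbreviation bounded_forms :: "('i::finite \<Rightarrow> ('k::{real_normed_field,banach}, 'a) nspace) \<Rightarrow>
    ('k, ('i \<Rightarrow> 'a) \<Rightarrow> 'k) nspace" where
  "bounded_forms X \<equiv> bounded_multilinear X scalars"


section \<open>Tensor products\<close>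

text \<open>
  As usual in functional analysis, \<open>x\<^sub>1 \<otimes> \<dots> \<otimes> x\<^sub>n\<close> is the functional \<open>\<phi> \<mapsto> \<phi> (x\<^sub>1, \<dots>, x\<^sub>n)\<close> on the
  space of all (not necessarily bounded) scalar \<open>n\<close>-linear forms, and the algebraic tensor product
  is the linear span of these functionals.
\<close>

definition tens :: "('i::finite \<Rightarrow> ('k::{real_normed_field,banach}, 'a, 'm) vspace_scheme) \<Rightarrow>
    ('i \<Rightarrow> 'a) \<Rightarrow> (('i \<Rightarrow> 'a) \<Rightarrow> 'k) \<Rightarrow> 'k" where
  "tens X x = (\<lambda>\<phi>\<in>forms X. \<phi> x)"

definition tensor :: "('i::finite \<Rightarrow> ('k::{real_normed_field,banach}, 'a, 'm) vspace_scheme) \<Rightarrow>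
    ('k, (('i \<Rightarrow> 'a) \<Rightarrow> 'k) \<Rightarrow> 'k) vspace" where
  "tensor X = \<lparr>
     carr = {(\<lambda>\<phi>\<in>forms X. \<Sum>j<m. c j * tens X (x j) \<phi>) |
       (m::nat) (c :: nat \<Rightarrow> 'k) x. \<forall>j<m. x j \<in> tuples X},
     vzero = (\<lambda>\<phi>\<in>forms X. 0),
     vadd = (\<lambda>s t. \<lambda>\<phi>\<in>forms X. s \<phi> + t \<phi>),
     vscale = (\<lambda>a t. \<lambda>\<phi>\<in>forms X. a * t \<phi>)\<rparr>"

text \<open>
  \<open>tens_last X Y t y\<close> is \<open>t \<otimes> y \<in> X\<^sub>1 \<otimes> \<dots> \<otimes> X\<^sub>n \<otimes> Y\<close> for \<open>t \<in> X\<^sub>1 \<otimes> \<dots> \<otimes> X\<^sub>n\<close> and \<open>y \<in> Y\<close>: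
  the linear extension in \<open>t\<close> of \<open>(x\<^sub>1 \<otimes> \<dots> \<otimes> x\<^sub>n, y) \<mapsto> x\<^sub>1 \<otimes> \<dots> \<otimes> x\<^sub>n \<otimes> y\<close>.
\<close>

definition tens_last :: "('i::finite \<Rightarrow> ('k::{real_normed_field,banach}, 'a, 'm) vspace_scheme) \<Rightarrow>
    ('k, 'a, 'm) vspace_scheme \<Rightarrow> ((('i \<Rightarrow> 'a) \<Rightarrow> 'k) \<Rightarrow> 'k) \<Rightarrow> 'a \<Rightarrow>
    (('i option \<Rightarrow> 'a) \<Rightarrow> 'k) \<Rightarrow> 'k" where
  "tens_last X Y t y = (\<lambda>\<psi>\<in>forms (snoc X Y). t (\<lambda>x\<in>tuples X. \<psi> (snoc x y)))"

definition Sigma_tens :: "('i::finite \<Rightarrow> ('k::{real_normed_field,banach}, 'a, 'm) vspace_scheme) \<Rightarrow>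
    ((('i \<Rightarrow> 'a) \<Rightarrow> 'k) \<Rightarrow> 'k) set" where
  "Sigma_tens X = tens X ` tuples X"

text \<open>
  A form \<open>\<phi>\<close> viewed as a function on \<open>\<Sigma>\<close>. Since \<open>x\<^sub>1 \<otimes> \<dots> \<otimes> x\<^sub>n\<close> is evaluation at
  \<open>(x\<^sub>1, \<dots>, x\<^sub>n)\<close>, its value at \<open>p\<close> is \<open>p \<phi>\<close>; see \<open>on_Sigma_tens\<close> below.
\<close>

definition on_Sigma :: "('i::finite \<Rightarrow> ('k::{real_normed_field,banach}, 'a, 'm) vspace_scheme) \<Rightarrow>
    (('i \<Rightarrow> 'a) \<Rightarrow> 'k) \<Rightarrow> ((('i \<Rightarrow> 'a) \<Rightarrow> 'k) \<Rightarrow> 'k) \<Rightarrow> 'k" where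
  "on_Sigma X \<phi> = (\<lambda>p\<in>Sigma_tens X. p \<phi>)"

lemma on_Sigma_tens:
  assumes "\<phi> \<in> forms X" and "x \<in> tuples X"
  shows "on_Sigma X \<phi> (tens X x) = \<phi> x"
  using assms by (simp add: on_Sigma_def Sigma_tens_def tens_def)

lemma form_fix_last:
  assumes psi: "\<psi> \<in> forms (snoc X Y)" and y: "y \<in> carr Y"
    and add_closed: "\<And>i u v. u \<in> carr (X i) \<Longrightarrow> v \<in> carr (X i) \<Longrightarrow> vadd (X i) u v \<in> carr (X i)"
    and scale_closed: "\<And>i a u. u \<in> carr (X i) \<Longrightarrow> vscale (X i) a u \<in> carr (X i)"
  shows "(\<lambda>x\<in>tuples X. \<psi> (snoc x y)) \<in> forms X"
proof -
  have snoc_in: "snoc x y \<in> tuples (snoc X Y)" if "x \<in> tuples X" for x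
    using that y by (auto simp: tuples_def Pi_iff split: option.split)
  have upd: "snoc (x(i := u)) y = (snoc x y)(Some i := u)" for x i u
    by (auto simp: fun_eq_iff split: option.split)
  have upd_in: "x(i := u) \<in> tuples X" if "x \<in> tuples X" "u \<in> carr (X i)" for x i u
    using that by (auto simp: tuples_def Pi_iff)
  have add: "\<psi> ((snoc x y)(Some i := vadd (X i) u v)) =
      \<psi> ((snoc x y)(Some i := u)) + \<psi> ((snoc x y)(Some i := v))"
    if "x \<in> tuples X" "u \<in> carr (X i)" "v \<in> carr (X i)" for x i u v
  proof -
    have "\<forall>w\<in>tuples (snoc X Y). \<forall>j. \<forall>u\<in>carr (snoc X Y j). \<forall>v\<in>carr (snoc X Y j).
        \<psi> (w(j := vadd (snoc X Y j) u v)) = \<psi> (w(j := u)) + \<psi> (w(j := v))"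
      using psi by (simp add: multilinear_def scalars_def)
    from this[rule_format, OF snoc_in[OF that(1)], of u "Some i" v] show ?thesis
      using that by simp
  qed
  have scale: "\<psi> ((snoc x y)(Some i := vscale (X i) a u)) = a * \<psi> ((snoc x y)(Some i := u))"
    if "x \<in> tuples X" "u \<in> carr (X i)" for x i u a
  proof -
    have "\<forall>w\<in>tuples (snoc X Y). \<forall>j. \<forall>u\<in>carr (snoc X Y j). \<forall>a.
        \<psi> (w(j := vscale (snoc X Y j) a u)) = a * \<psi> (w(j := u))"
      using psi by (simp add: multilinear_def scalars_def)
    from this[rule_format, OF snoc_in[OF that(1)], of u "Some i" a] show ?thesis
      using that by simp
  qed
  show ?thesis
    using add_closed scale_closed
    by (simp add: multilinear_def scalars_def upd upd_in add scale)
qed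

lemma tens_last_tens:
  assumes x: "x \<in> tuples X" and y: "y \<in> carr Y" and X: "\<And>i. normed_space (X i)"
  shows "tens_last X Y (tens X x) y = tens (snoc X Y) (snoc x y)"
proof -
  have "(\<lambda>x\<in>tuples X. \<psi> (snoc x y)) \<in> forms X" if "\<psi> \<in> forms (snoc X Y)" for \<psi>
    by (rule form_fix_last[OF that y normed_space.add_closed[OF X] normed_space.scale_closed[OF X]])
  then show ?thesis
    using x by (auto simp: tens_last_def tens_def fun_eq_iff)
qed


section \<open>The tensor norm and Lipschitz summing operators\<close>

text \<open>The \<open>0\<close> inserted for \<open>p = \<infinity>\<close> only matters for the empty sequence.\<close>

definition lp_norm :: "ereal \<Rightarrow> nat \<Rightarrow> (nat \<Rightarrow> real) \<Rightarrow> real" where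
  "lp_norm p k a =
     (if p = \<infinity> then Max (insert 0 ((\<lambda>i. \<bar>a i\<bar>) ` {..<k}))
      else (\<Sum>i<k. \<bar>a i\<bar> powr real_of_ereal p) powr (1 / real_of_ereal p))"

definition d_Lip :: "ereal \<Rightarrow> real \<Rightarrow> ('i::finite \<Rightarrow> ('k::{real_normed_field,banach}, 'a) nspace) \<Rightarrow>
    ('k, 'a) nspace \<Rightarrow> ((('i option \<Rightarrow> 'a) \<Rightarrow> 'k) \<Rightarrow> 'k) \<Rightarrow> real" where
  "d_Lip p p' X Y z = Inf {
     (SUP f\<in>on_Sigma X ` unit_ball (bounded_forms X).
        (\<Sum>i<k. norm (f (P i) - f (Q i)) powr p') powr (1 / p'))
      * lp_norm p k (\<lambda>i. vnorm Y (y i)) | k P Q y.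
     (\<forall>i<k. P i \<in> Sigma_tens X \<and> Q i \<in> Sigma_tens X \<and> y i \<in> carr Y) \<and>
     z = vsum (tensor (snoc X Y)) (\<lambda>i. tens_last X Y (vdiff (tensor X) (P i) (Q i)) (y i)) k}"

definition lip_tensor :: "ereal \<Rightarrow> real \<Rightarrow>
    ('i::finite \<Rightarrow> ('k::{real_normed_field,banach}, 'a) nspace) \<Rightarrow> ('k, 'a) nspace \<Rightarrow>
    ('k, (('i option \<Rightarrow> 'a) \<Rightarrow> 'k) \<Rightarrow> 'k) nspace" where
  "lip_tensor p p' X Y = vspace.extend (tensor (snoc X Y)) (nspace.fields (d_Lip p p' X Y))"

lemma lip_tensor_simps [simp]:
  "carr (lip_tensor p p' X Y) = carr (tensor (snoc X Y))"
  "vzero (lip_tensor p p' X Y) = vzero (tensor (snoc X Y))"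
  "vadd (lip_tensor p p' X Y) = vadd (tensor (snoc X Y))"
  "vscale (lip_tensor p p' X Y) = vscale (tensor (snoc X Y))"
  "vnorm (lip_tensor p p' X Y) = d_Lip p p' X Y"
  by (simp_all add: lip_tensor_def vspace.defs nspace.defs)

definition lip_summing_bound :: "real \<Rightarrow>
    ('i::finite \<Rightarrow> ('k::{real_normed_field,banach}, 'a) nspace) \<Rightarrow> ('k, 'b) nspace \<Rightarrow>
    (('i \<Rightarrow> 'a) \<Rightarrow> 'b) \<Rightarrow> real \<Rightarrow> bool" where
  "lip_summing_bound r X Z T c \<longleftrightarrow>
     (\<forall>(k::nat) u v. (\<forall>i<k. u i \<in> tuples X \<and> v i \<in> tuples X) \<longrightarrow>
        (\<Sum>i<k. vnorm Z (vdiff Z (T (u i)) (T (v i))) powr r) powr (1 / r)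
        \<le> c * (SUP \<phi>\<in>unit_ball (bounded_forms X).
                 (\<Sum>i<k. norm (\<phi> (u i) - \<phi> (v i)) powr r) powr (1 / r)))"

definition lip_summing :: "real \<Rightarrow>
    ('i::finite \<Rightarrow> ('k::{real_normed_field,banach}, 'a) nspace) \<Rightarrow> ('k, 'b) nspace \<Rightarrow>
    ('k, ('i \<Rightarrow> 'a) \<Rightarrow> 'b) nspace" where
  "lip_summing r X Z = bounded_multilinear X Z \<lparr>
     carr := {T \<in> carr (bounded_multilinear X Z). \<exists>c>0. lip_summing_bound r X Z T c},
     vnorm := (\<lambda>T. Inf {c. c > 0 \<and> lip_summing_bound r X Z T c})\<rparr>"

end

theory Submission
  imports Defs
begin

text \<open>
  An elementary tensor is evaluation of multilinear forms at a tuple, and the algebraic tensor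
  product consists of the finite linear combinations of such evaluations. Hence a multilinear map
  \<open>T\<close> into \<open>Y\<^sup>*\<close> gives a functional on \<open>X\<^sub>1 \<otimes> \<dots> \<otimes> X\<^sub>n \<otimes> Y\<close> for free: uncurry \<open>T\<close> to an
  \<open>(n+1)\<close>-linear form and evaluate tensors at it. Well-definedness is built in, and if
  \<open>z = \<Sum> (p\<^sub>i - q\<^sub>i) \<otimes> y\<^sub>i\<close> with \<open>p\<^sub>i = \<otimes>u\<^sub>i\<close> and \<open>q\<^sub>i = \<otimes>v\<^sub>i\<close>, the value at \<open>z\<close> is
  \<open>\<Sum> (T(u\<^sub>i) - T(v\<^sub>i))(y\<^sub>i)\<close>.

  The heart of the matter is that for \<open>c > 0\<close> the functional is bounded by \<open>c d\<^sub>p\<close> if and only if \<open>T\<close>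
  satisfies the Lipschitz \<open>p'\<close>-summing inequality with the constant \<open>c\<close>. If \<open>T\<close> does, Hoelder's
  inequality applied to each representation of \<open>z\<close> bounds the value by \<open>c\<close> times the cost of that
  representation (\<open>tensor_functional_bound\<close>). Conversely, given tuples \<open>u\<^sub>i\<close>, \<open>v\<^sub>i\<close>, choose
  \<open>y\<^sub>i\<close> in the unit ball almost norming for \<open>T(u\<^sub>i) - T(v\<^sub>i)\<close> and weights \<open>b\<close> in the \<open>\<ell>\<^sub>p\<close> ball for which
  Hoelder's inequality is an equality; testing the functional on \<open>\<Sum> (p\<^sub>i - q\<^sub>i) \<otimes> b\<^sub>i y\<^sub>i\<close>, with the
  phases adjusted, gives the summing inequality (\<open>lip_summing_bound_if\<close>). This makes
  the correspondence isometric; it is onto because a bounded functional can be restricted to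
  elementary tensors, whose norm is at most \<open>\<parallel>x\<^sub>1\<parallel> \<cdots> \<parallel>x\<^sub>n\<parallel> \<parallel>y\<parallel>\<close>
  (\<open>tensor_functional_surj\<close>).

  Passing to the completion is soft: bounded functionals extend uniquely and isometrically along
  Cauchy sequences (\<open>isometric_iso_extend_functional\<close>). The completion divides out the null
  sequences, so all of this makes sense for seminorms, and the argument is carried out for seminormed
  spaces. The one nontrivial seminorm axiom for \<open>d\<^sub>p\<close> is the triangle inequality (\<open>d_Lip_triangle\<close>): by
  homogeneity the two factors of the cost of a representation can be balanced against each other
  (\<open>balanced_rep\<close>), after which representations of two tensors can be concatenated without loss.
\<close>

section \<open>Finite sequences and conjugate exponents\<close>

definition concat_seq :: "nat \<Rightarrow> (nat \<Rightarrow> 'b) \<Rightarrow> (nat \<Rightarrow> 'b) \<Rightarrow> nat \<Rightarrow> 'b" where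
  "concat_seq k f g = (\<lambda>i. if i < k then f i else g (i - k))"

lemma sum_lessThan_add:
  fixes f :: "nat \<Rightarrow> 'b::comm_monoid_add"
  shows "(\<Sum>i<k+l. f i) = (\<Sum>i<k. f i) + (\<Sum>i<l. f (k + i))"
  by (induction l) (simp_all add: add.assoc)

text \<open>For real \<open>r\<close> the extended-real equation leaves only these cases: \<open>r = 0\<close> would make \<open>1 / r\<close>
  infinite, and \<open>1 < p\<close> excludes negative values.\<close>

lemma conjugate_exponent_cases:
  assumes "1 < p" and "1 / p + 1 / ereal r = 1"
  obtains "p = \<infinity>" "r = 1"
  | q where "p = ereal q" "1 < q" "1 < r" "1 / q + 1 / r = 1"
proof (cases p)
  case (real q)
  have r0: "r \<noteq> 0"
    using assms real by (auto simp: divide_ereal_def one_ereal_def)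
  have q: "1 < q"
    using assms(1) real by (simp add: one_ereal_def)
  have eq: "1 / q + 1 / r = 1"
    using assms(2) real r0 q by (simp add: divide_ereal_def one_ereal_def divide_inverse)
  have "0 < 1 / q" "1 / q < 1"
    using q by auto
  with eq have r': "0 < 1 / r" "1 / r < 1" by linarith+
  then have "1 < r"
    using r0 by (auto simp: divide_simps split: if_splits)
  with real q eq show ?thesis by (intro that(2))
next
  case PInf
  have "r \<noteq> 0"
    using assms PInf by (auto simp: divide_ereal_def one_ereal_def)
  then have "r = 1"
    using assms(2) PInf by (simp add: divide_ereal_def one_ereal_def divide_inverse)
  with PInf show ?thesis by (intro that(1))
next
  case MInf
  then show ?thesis using assms(1) by simp
qed

lemma lp_norm_nonneg: "0 \<le> lp_norm p k a"
  by (auto simp: lp_norm_def)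

lemma lp_norm_mono:
  assumes "1 < p" and "\<And>i. i < k \<Longrightarrow> \<bar>a i\<bar> \<le> \<bar>b i\<bar>"
  shows "lp_norm p k a \<le> lp_norm p k b"
proof (cases "p = \<infinity>")
  case True
  have "\<bar>a i\<bar> \<le> Max (insert 0 ((\<lambda>i. \<bar>b i\<bar>) ` {..<k}))" if "i < k" for i
    using assms(2)[OF that] by (rule order_trans) (use that in auto)
  then show ?thesis
    using True by (simp add: lp_norm_def)
next
  case False
  with assms(1) obtain q where q: "p = ereal q" "1 < q"
    by (cases p) (auto simp: one_ereal_def)
  have "(\<Sum>i<k. \<bar>a i\<bar> powr q) \<le> (\<Sum>i<k. \<bar>b i\<bar> powr q)"
    by (intro sum_mono powr_mono2) (use assms q in auto)
  then show ?thesis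
    using q by (auto simp: lp_norm_def intro!: powr_mono2 sum_nonneg)
qed

lemma lp_norm_scale:
  assumes "1 < p" and "0 \<le> c"
  shows "lp_norm p k (\<lambda>i. c * a i) \<le> c * lp_norm p k a"
proof (cases "p = \<infinity>")
  case True
  have "\<bar>a i\<bar> \<le> Max (insert 0 ((\<lambda>i. \<bar>a i\<bar>) ` {..<k}))" if "i < k" for i
    using that by auto
  then show ?thesis
    using True assms(2) by (auto simp: lp_norm_def abs_mult intro!: mult_left_mono)
next
  case False
  with assms(1) obtain q where q: "p = ereal q" "1 < q"
    by (cases p) (auto simp: one_ereal_def)
  then show ?thesis
    using assms(2) by (simp add: lp_norm_def abs_mult powr_mult powr_powr flip: sum_distrib_left)
qed

text \<open>The exponent \<open>1 - 1 / r\<close> is \<open>1 / p\<close>, read as \<open>0\<close> for \<open>p = \<infinity>\<close>. For finite \<open>p\<close> the \<open>p\<close>-th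
  powers of the norms add up; for \<open>p = \<infinity>\<close> all three bounds are \<open>1\<close>, since \<open>\<alpha>\<close> and \<open>\<beta>\<close> are
  positive.\<close>

lemma lp_norm_append_le:
  assumes conj: "1 < p" "1 / p + 1 / ereal r = 1" and pos: "0 < \<alpha>" "0 < \<beta>"
    and a: "lp_norm p k a \<le> \<alpha> powr (1 - 1 / r)" and b: "lp_norm p l b \<le> \<beta> powr (1 - 1 / r)"
  shows "lp_norm p (k + l) (concat_seq k a b) \<le> (\<alpha> + \<beta>) powr (1 - 1 / r)"
  using conj
proof (cases rule: conjugate_exponent_cases)
  case 1
  have "\<bar>a i\<bar> \<le> 1" if "i < k" for i
    using a 1 that pos by (auto simp: lp_norm_def)
  moreover have "\<bar>b i\<bar> \<le> 1" if "i < l" for i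
    using b 1 that pos by (auto simp: lp_norm_def)
  ultimately have "\<bar>concat_seq k a b i\<bar> \<le> 1" if "i < k + l" for i
    using that by (auto simp: concat_seq_def)
  with 1 pos show ?thesis
    by (simp add: lp_norm_def)
next
  case (2 q)
  have q: "1 - 1 / r = 1 / q" using 2 by linarith
  have le: "s \<le> \<gamma>" if "s powr (1 / q) \<le> \<gamma> powr (1 / q)" "0 < \<gamma>" for s \<gamma> :: real
    using that 2 powr_less_mono2[of "1/q" \<gamma> s] by force
  have "(\<Sum>i<k. \<bar>a i\<bar> powr q) \<le> \<alpha>" "(\<Sum>i<l. \<bar>b i\<bar> powr q) \<le> \<beta>"
    using a b 2 pos by (auto simp: lp_norm_def q intro: le)
  moreover have "(\<Sum>i<k+l. \<bar>concat_seq k a b i\<bar> powr q)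
      = (\<Sum>i<k. \<bar>a i\<bar> powr q) + (\<Sum>i<l. \<bar>b i\<bar> powr q)"
    by (simp add: sum_lessThan_add concat_seq_def)
  ultimately show ?thesis
    using 2 by (auto simp: lp_norm_def q intro!: powr_mono2 add_nonneg_nonneg sum_nonneg)
qed

text \<open>Young's inequality, summed over the entries after both sequences have been normalised.\<close>

lemma lp_Hoelder:
  assumes conj: "1 < p" "1 / p + 1 / ereal r = 1"
    and nonneg: "\<And>i. i < k \<Longrightarrow> 0 \<le> a i" "\<And>i. i < k \<Longrightarrow> 0 \<le> b i"
  shows "(\<Sum>i<k. a i * b i) \<le> (\<Sum>i<k. a i powr r) powr (1 / r) * lp_norm p k b"
  using conj
proof (cases rule: conjugate_exponent_cases)
  case 1
  have "b i \<le> lp_norm p k b" if "i < k" for i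
    using that 1 nonneg(2)[OF that] 
    by (auto simp: lp_norm_def intro!: Max_ge rev_image_eqI[of i])
  then have "(\<Sum>i<k. a i * b i) \<le> (\<Sum>i<k. a i * lp_norm p k b)"
    by (intro sum_mono mult_left_mono) (use nonneg in auto)
  moreover have "(\<Sum>i<k. \<bar>a i\<bar>) = (\<Sum>i<k. a i)" "0 \<le> (\<Sum>i<k. a i)"
    using nonneg by (auto intro!: sum.cong sum_nonneg)
  ultimately show ?thesis
    using 1 by (simp flip: sum_distrib_right)
next
  case (2 q)
  define A where "A = (\<Sum>i<k. a i powr r)"
  define B where "B = (\<Sum>i<k. b i powr q)"
  have AB: "0 \<le> A" "0 \<le> B"
    by (auto simp: A_def B_def intro: sum_nonneg)
  have lp: "lp_norm p k b = B powr (1 / q)"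
    using nonneg 2 by (simp add: lp_norm_def B_def)
  show ?thesis
  proof (cases "A = 0 \<or> B = 0")
    case True
    then have "a i * b i = 0" if "i < k" for i
      using that by (auto simp: A_def B_def sum_nonneg_eq_0_iff)
    then have "(\<Sum>i<k. a i * b i) = 0"
      by (intro sum.neutral) auto
    then show ?thesis using lp_norm_nonneg[of p k b] by simp
  next
    case False
    with AB have AB': "0 < A" "0 < B" by auto
    define A1 where "A1 = A powr (1 / r)"
    define B1 where "B1 = B powr (1 / q)"
    have 3: "0 < A1" "0 < B1" "A1 powr r = A" "B1 powr q = B"
      using AB' 2 by (auto simp: A1_def B1_def powr_powr)
    have "(a i / A1) * (b i / B1) \<le> a i powr r / A / r + b i powr q / B / q" if "i < k" for i
      using Youngs_inequality[of r q "a i / A1" "b i / B1"] 2 3 nonneg[OF that]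
      by (simp add: powr_divide add.commute)
    then have "(\<Sum>i<k. (a i / A1) * (b i / B1)) \<le> (\<Sum>i<k. a i powr r / A / r + b i powr q / B / q)"
      by (intro sum_mono) auto
    also have "\<dots> = A / A / r + B / B / q"
      by (simp add: A_def B_def sum.distrib flip: sum_divide_distrib)
    also have "\<dots> = 1" using AB' 2 by simp
    finally have "(\<Sum>i<k. a i * b i) / (A1 * B1) \<le> 1"
      by (simp add: sum_divide_distrib)
    then have "(\<Sum>i<k. a i * b i) \<le> A1 * B1"
      using 3 by (simp add: divide_simps)
    then show ?thesis
      unfolding A1_def B1_def lp A_def .
  qed
qed

text \<open>The equality case: \<open>b\<close> is \<open>t\<^sup>r\<^sup>-\<^sup>1\<close>, normalised. For \<open>r = 1\<close> it is the constant sequence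
  \<open>1\<close>.\<close>

lemma lp_Hoelder_attained:
  assumes conj: "1 < p" "1 / p + 1 / ereal r = 1" and nonneg: "\<And>i. i < k \<Longrightarrow> 0 \<le> t i"
  obtains b where "\<And>i. 0 \<le> b i" "lp_norm p k b \<le> 1"
    "(\<Sum>i<k. b i * t i) = (\<Sum>i<k. t i powr r) powr (1 / r)"
  using conj
proof (cases rule: conjugate_exponent_cases)
  case 1
  have "(\<Sum>i<k. \<bar>t i\<bar>) = (\<Sum>i<k. t i)" "0 \<le> (\<Sum>i<k. t i)"
    using nonneg by (auto intro!: sum.cong sum_nonneg)
  with 1 show ?thesis
    by (intro that[of "\<lambda>i. 1"]) (auto simp: lp_norm_def)
next
  case (2 q)
  define S where "S = (\<Sum>i<k. t i powr r)"
  have S: "0 \<le> S" by (auto simp: S_def intro: sum_nonneg)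
  show ?thesis
  proof (cases "S = 0")
    case True
    show ?thesis
      by (rule that[of "\<lambda>i. 0"]) (use 2 True in \<open>auto simp: lp_norm_def S_def\<close>)
  next
    case False
    with S have S: "0 < S" by simp
    define b where "b i = t i powr (r - 1) / S powr (1 / q)" for i
    have exps: "(r - 1) * q = r" "1 - 1 / q = 1 / r"
      using 2 by (auto simp: field_simps)
    have "\<bar>b i\<bar> powr q = t i powr r / S" for i
      using S 2 by (simp add: b_def powr_divide powr_powr exps)
    then have "(\<Sum>i<k. \<bar>b i\<bar> powr q) = 1"
      using S by (simp add: S_def flip: sum_divide_distrib)
    then have "lp_norm p k b \<le> 1"
      using 2 by (simp add: lp_norm_def)
    moreover have "b i * t i = t i powr r / S powr (1 / q)" if "i < k" for i
      using powr_mult_base[OF nonneg[OF that], of "r - 1"]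
      by (simp add: b_def mult.commute)
    then have "(\<Sum>i<k. b i * t i) = S / S powr (1 / q)"
      by (simp add: S_def flip: sum_divide_distrib)
    then have "(\<Sum>i<k. b i * t i) = S powr (1 / r)"
      using S powr_diff[of S 1 "1 / q"] by (simp add: exps)
    ultimately show ?thesis
      by (intro that[of b]) (auto simp: b_def S_def)
  qed
qed

section \<open>Seminormed spaces\<close>

text \<open>The axioms of a normed space without definiteness, in the form in which they are established
  for the tensor norm. Duals and completions are constructed in the same way at this generality, as
  vectors of seminorm \<open>0\<close> vanish under bounded functionals and become \<open>0\<close> in the completion.\<close>

locale seminormed_space =
  fixes V :: "('k::{real_normed_field,banach}, 'a) nspace"
  assumes zero_closed: "vzero V \<in> carr V"
    and add_closed: "x \<in> carr V \<Longrightarrow> y \<in> carr V \<Longrightarrow> vadd V x y \<in> carr V"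
    and scale_closed: "x \<in> carr V \<Longrightarrow> vscale V a x \<in> carr V"
    and add_assoc: "x \<in> carr V \<Longrightarrow> y \<in> carr V \<Longrightarrow> z \<in> carr V \<Longrightarrow>
          vadd V (vadd V x y) z = vadd V x (vadd V y z)"
    and add_commute: "x \<in> carr V \<Longrightarrow> y \<in> carr V \<Longrightarrow> vadd V x y = vadd V y x"
    and add_zero: "x \<in> carr V \<Longrightarrow> vadd V x (vzero V) = x"
    and diff_self: "x \<in> carr V \<Longrightarrow> vdiff V x x = vzero V"
    and scale_add_right: "x \<in> carr V \<Longrightarrow> y \<in> carr V \<Longrightarrow>
          vscale V a (vadd V x y) = vadd V (vscale V a x) (vscale V a y)"
    and scale_add_left: "x \<in> carr V \<Longrightarrow> vscale V (a + b) x = vadd V (vscale V a x) (vscale V b x)"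
    and scale_scale: "x \<in> carr V \<Longrightarrow> vscale V a (vscale V b x) = vscale V (a * b) x"
    and scale_one: "x \<in> carr V \<Longrightarrow> vscale V 1 x = x"
    and norm_nonneg: "x \<in> carr V \<Longrightarrow> 0 \<le> vnorm V x"
    and norm_triangle: "x \<in> carr V \<Longrightarrow> y \<in> carr V \<Longrightarrow> vnorm V (vadd V x y) \<le> vnorm V x + vnorm V y"
    and norm_scale: "x \<in> carr V \<Longrightarrow> vnorm V (vscale V a x) = norm a * vnorm V x"

lemma normed_space_imp_seminormed_space:
  assumes "normed_space V"
  shows "seminormed_space V"
proof -
  interpret normed_space V by fact
  show ?thesis
    by (unfold_locales)
      (fact zero_closed add_closed scale_closed add_assoc add_commute add_zero diff_self
        scale_add_right scale_add_left scale_scale scale_one norm_nonneg norm_triangle norm_scale)+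
qed

context seminormed_space
begin

lemma scale_zero: "x \<in> carr V \<Longrightarrow> vscale V 0 x = vzero V"
  using scale_add_left[of x 1 "- 1"] diff_self[of x] by (simp add: scale_one vdiff_def)

lemma norm_zero: "vnorm V (vzero V) = 0"
  using norm_scale[OF zero_closed, of 0] by (simp add: scale_zero zero_closed)

lemma diff_closed: "x \<in> carr V \<Longrightarrow> y \<in> carr V \<Longrightarrow> vdiff V x y \<in> carr V"
  by (simp add: vdiff_def add_closed scale_closed)

lemma add_left_commute:
  assumes "x \<in> carr V" "y \<in> carr V" "z \<in> carr V"
  shows "vadd V x (vadd V y z) = vadd V y (vadd V x z)"
  using assms by (metis add_assoc add_commute)

lemma add_diff_add:
  assumes "x \<in> carr V" "y \<in> carr V" "u \<in> carr V" "v \<in> carr V"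
  shows "vdiff V (vadd V x y) (vadd V u v) = vadd V (vdiff V x u) (vdiff V y v)"
  using assms
  by (simp add: vdiff_def scale_add_right add_assoc add_closed scale_closed add_left_commute)

lemma diff_scale:
  assumes "x \<in> carr V" "y \<in> carr V"
  shows "vdiff V (vscale V a x) (vscale V a y) = vscale V a (vdiff V x y)"
  using assms by (simp add: vdiff_def scale_add_right scale_scale scale_closed)

lemma diff_add_diff:
  assumes "x \<in> carr V" "y \<in> carr V" "z \<in> carr V"
  shows "vadd V (vdiff V x y) (vdiff V y z) = vdiff V x z"
proof -
  let ?y = "vscale V (- 1) y" and ?z = "vscale V (- 1) z"
  have c: "?y \<in> carr V" "?z \<in> carr V" using assms by (simp_all add: scale_closed)
  have "vadd V ?y (vadd V y ?z) = vadd V ?z (vadd V y ?y)"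
    using assms c add_assoc[of ?y y ?z] add_commute[of ?y y] add_commute[of ?z "vadd V y ?y"]
    by (simp add: add_closed)
  also have "\<dots> = ?z"
    using assms c diff_self[of y] by (simp add: vdiff_def add_zero)
  finally show ?thesis
    using assms c by (simp add: vdiff_def add_assoc add_closed)
qed

lemma norm_diff_commute:
  assumes "x \<in> carr V" "y \<in> carr V"
  shows "vnorm V (vdiff V x y) = vnorm V (vdiff V y x)"
proof -
  have "vdiff V y x = vscale V (- 1) (vdiff V x y)"
    using assms by (simp add: vdiff_def scale_add_right scale_scale scale_closed scale_one add_commute)
  then show ?thesis
    using assms by (simp add: norm_scale diff_closed)
qed

lemma norm_diff_triangle:
  assumes "x \<in> carr V" "y \<in> carr V" "z \<in> carr V"
  shows "vnorm V (vdiff V x z) \<le> vnorm V (vdiff V x y) + vnorm V (vdiff V y z)"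
  using norm_triangle[OF diff_closed[OF assms(1,2)] diff_closed[OF assms(2,3)]] assms
  by (simp add: diff_add_diff)

lemma norm_le_norm_diff_add:
  assumes "x \<in> carr V" "y \<in> carr V"
  shows "vnorm V x \<le> vnorm V (vdiff V x y) + vnorm V y"
proof -
  have d0: "vdiff V u (vzero V) = u" if "u \<in> carr V" for u
    using that scale_scale[OF zero_closed, of "- 1" 0]
    by (simp add: vdiff_def scale_zero zero_closed add_zero)
  show ?thesis
    using norm_diff_triangle[OF assms zero_closed] assms by (simp add: d0)
qed

lemma abs_norm_diff_le:
  assumes "x \<in> carr V" "y \<in> carr V"
  shows "\<bar>vnorm V x - vnorm V y\<bar> \<le> vnorm V (vdiff V x y)"
  using norm_le_norm_diff_add[OF assms] norm_le_norm_diff_add[OF assms(2,1)]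
    norm_diff_commute[OF assms] by linarith

end

section \<open>The dual of a seminormed space\<close>

lemma dual_simps:
  "vzero (dual V) = (\<lambda>x\<in>carr V. 0)"
  "vadd (dual V) f g = (\<lambda>x\<in>carr V. f x + g x)"
  "vscale (dual V) a f = (\<lambda>x\<in>carr V. a * f x)"
  "vnorm (dual V) f = (SUP x\<in>unit_ball V. norm (f x))"
  by (simp_all add: dual_def)

lemma mem_dual_iff:
  "f \<in> carr (dual V) \<longleftrightarrow> f \<in> extensional (carr V) \<and>
     (\<forall>x\<in>carr V. \<forall>y\<in>carr V. f (vadd V x y) = f x + f y) \<and>
     (\<forall>a. \<forall>x\<in>carr V. f (vscale V a x) = a * f x) \<and>
     (\<exists>C. \<forall>x\<in>carr V. norm (f x) \<le> C * vnorm V x)"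
  by (simp add: dual_def)

context seminormed_space
begin

lemma dual_diff:
  assumes "f \<in> carr (dual V)" "x \<in> carr V" "y \<in> carr V"
  shows "f (vdiff V x y) = f x - f y"
  using assms by (simp add: mem_dual_iff vdiff_def scale_closed)

lemma dual_unit_ball_bdd:
  assumes "f \<in> carr (dual V)"
  shows "bdd_above ((\<lambda>x. norm (f x)) ` unit_ball V)"
proof -
  obtain C where C: "\<forall>x\<in>carr V. norm (f x) \<le> C * vnorm V x"
    using assms by (auto simp: mem_dual_iff)
  have "norm (f x) \<le> max 0 C" if "x \<in> unit_ball V" for x
  proof -
    have "x \<in> carr V" "vnorm V x \<le> 1" "0 \<le> vnorm V x"
      using that norm_nonneg by (auto simp: unit_ball_def)
    then have "norm (f x) \<le> C * vnorm V x" "C * vnorm V x \<le> max 0 C * 1"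
      using C by (blast, intro mult_mono) auto
    then show ?thesis by simp
  qed
  then show ?thesis by (intro bdd_aboveI2)
qed

lemma zero_in_unit_ball: "vzero V \<in> unit_ball V"
  by (simp add: unit_ball_def zero_closed norm_zero)

lemma dual_norm_le:
  assumes "\<And>x. x \<in> carr V \<Longrightarrow> norm (f x) \<le> c * vnorm V x" and "0 \<le> c"
  shows "vnorm (dual V) f \<le> c"
  unfolding dual_simps
proof (rule cSUP_least)
  show "unit_ball V \<noteq> {}" using zero_in_unit_ball by auto
  fix x assume "x \<in> unit_ball V"
  then have "x \<in> carr V" "vnorm V x \<le> 1" by (auto simp: unit_ball_def)
  then have "norm (f x) \<le> c * vnorm V x" "c * vnorm V x \<le> c"
    using assms by (auto intro: mult_left_le)
  then show "norm (f x) \<le> c" by simp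
qed

lemma dual_norm_nonneg:
  assumes "f \<in> carr (dual V)"
  shows "0 \<le> vnorm (dual V) f"
proof -
  have "norm (f (vzero V)) \<le> vnorm (dual V) f"
    unfolding dual_simps
    by (rule cSUP_upper[OF zero_in_unit_ball dual_unit_ball_bdd[OF assms]])
  then show ?thesis using norm_ge_zero order_trans by blast
qed

text \<open>A vector of seminorm \<open>0\<close> cannot be normalised, but boundedness makes the functional vanish
  on it.\<close>

lemma dual_norm_bound:
  assumes f: "f \<in> carr (dual V)" and x: "x \<in> carr V"
  shows "norm (f x) \<le> vnorm (dual V) f * vnorm V x"
proof (cases "vnorm V x = 0")
  case True
  obtain C where "\<forall>x\<in>carr V. norm (f x) \<le> C * vnorm V x"
    using f by (auto simp: mem_dual_iff)
  with x have "norm (f x) \<le> C * vnorm V x" by blast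
  with True show ?thesis by simp
next
  case False
  with norm_nonneg[OF x] have pos: "0 < vnorm V x" by simp
  let ?a = "of_real (1 / vnorm V x) :: 'k"
  have "vscale V ?a x \<in> unit_ball V"
    using x pos by (simp add: unit_ball_def scale_closed norm_scale norm_divide)
  then have "norm (f (vscale V ?a x)) \<le> vnorm (dual V) f"
    unfolding dual_simps by (rule cSUP_upper[OF _ dual_unit_ball_bdd[OF f]])
  moreover have "f (vscale V ?a x) = ?a * f x"
    using f x by (auto simp: mem_dual_iff)
  ultimately have "norm (?a * f x) \<le> vnorm (dual V) f" by simp
  then show ?thesis
    using pos by (simp add: norm_mult norm_divide pos_divide_le_eq)
qed

lemma dual_norm_le_iff:
  assumes "f \<in> carr (dual V)" and "0 \<le> c"
  shows "vnorm (dual V) f \<le> c \<longleftrightarrow> (\<forall>x\<in>carr V. norm (f x) \<le> c * vnorm V x)"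
proof
  assume le: "vnorm (dual V) f \<le> c"
  show "\<forall>x\<in>carr V. norm (f x) \<le> c * vnorm V x"
  proof
    fix x assume x: "x \<in> carr V"
    show "norm (f x) \<le> c * vnorm V x"
      using dual_norm_bound[OF assms(1) x] mult_right_mono[OF le norm_nonneg[OF x]] by linarith
  qed
qed (use assms dual_norm_le in auto)

lemma dual_add_closed:
  assumes "f \<in> carr (dual V)" "g \<in> carr (dual V)"
  shows "vadd (dual V) f g \<in> carr (dual V)"
proof -
  obtain C D where "\<forall>x\<in>carr V. norm (f x) \<le> C * vnorm V x" "\<forall>x\<in>carr V. norm (g x) \<le> D * vnorm V x"
    using assms by (auto simp: mem_dual_iff)
  then have "norm (f x + g x) \<le> (C + D) * vnorm V x" if "x \<in> carr V" for x
    using that norm_triangle_ineq[of "f x" "g x"] by (force simp: distrib_right)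
  with assms show ?thesis
    by (auto simp: mem_dual_iff dual_simps add_closed scale_closed distrib_left)
qed

lemma dual_scale_closed:
  assumes "f \<in> carr (dual V)"
  shows "vscale (dual V) a f \<in> carr (dual V)"
proof -
  obtain C where "\<forall>x\<in>carr V. norm (f x) \<le> C * vnorm V x"
    using assms by (auto simp: mem_dual_iff)
  then have "norm (a * f x) \<le> (norm a * C) * vnorm V x" if "x \<in> carr V" for x
    using that by (simp add: norm_mult mult.assoc mult_left_mono)
  with assms show ?thesis
    by (auto simp: mem_dual_iff dual_simps add_closed scale_closed distrib_left)
qed

text \<open>A substitute for attaining the dual norm. Testing against a fixed
  fraction \<open>c\<close> of the norm, rather than the norm minus an error, suits homogeneous inequalities: the
  factor \<open>c\<close> can be pulled out of an \<open>\<ell>\<^sub>r\<close> sum.\<close>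

lemma dual_norm_approx:
  assumes f: "f \<in> carr (dual V)" and c: "0 < c" "c < 1"
  shows "\<exists>x\<in>unit_ball V. c * vnorm (dual V) f \<le> norm (f x)"
proof (cases "vnorm (dual V) f = 0")
  case True
  then show ?thesis using zero_in_unit_ball by auto
next
  case False
  with dual_norm_nonneg[OF f] have "0 < vnorm (dual V) f" by simp
  then have "c * vnorm (dual V) f < (SUP x\<in>unit_ball V. norm (f x))"
    using c by (simp add: dual_simps)
  then obtain x where "x \<in> unit_ball V" "c * vnorm (dual V) f < norm (f x)"
    using zero_in_unit_ball less_cSUP_iff[OF _ dual_unit_ball_bdd[OF f]] by blast
  then show ?thesis by (intro bexI[of _ x]) auto
qed

lemma dual_diff_apply:
  assumes "f \<in> carr (dual V)" "g \<in> carr (dual V)"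
  shows "vdiff (dual V) f g \<in> carr (dual V)"
    and "x \<in> carr V \<Longrightarrow> vdiff (dual V) f g x = f x - g x"
  using assms by (auto simp: vdiff_def dual_add_closed dual_scale_closed) (simp add: dual_simps)

end

section \<open>Completion\<close>

context seminormed_space
begin

lemma cauchy_seq_closed: "cauchy_seq V s \<Longrightarrow> s n \<in> carr V"
  by (simp add: cauchy_seq_def)

lemma cauchy_seq_const: "x \<in> carr V \<Longrightarrow> cauchy_seq V (\<lambda>n. x)"
  by (simp add: cauchy_seq_def diff_self norm_zero)

lemma cauchy_seq_add:
  assumes s: "cauchy_seq V s" and t: "cauchy_seq V t"
  shows "cauchy_seq V (\<lambda>n. vadd V (s n) (t n))"
  unfolding cauchy_seq_def
proof (intro conjI allI impI)
  show "vadd V (s n) (t n) \<in> carr V" for n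
    using assms by (simp add: cauchy_seq_closed add_closed)
  fix e :: real assume "0 < e"
  then have e2: "0 < e / 2" by simp
  obtain N where N: "\<forall>m\<ge>N. \<forall>n\<ge>N. vnorm V (vdiff V (s m) (s n)) < e / 2"
    using s e2 unfolding cauchy_seq_def by blast
  obtain M where M: "\<forall>m\<ge>M. \<forall>n\<ge>M. vnorm V (vdiff V (t m) (t n)) < e / 2"
    using t e2 unfolding cauchy_seq_def by blast
  show "\<exists>N. \<forall>m\<ge>N. \<forall>n\<ge>N. vnorm V (vdiff V (vadd V (s m) (t m)) (vadd V (s n) (t n))) < e"
  proof (intro exI allI impI)
    fix m n assume mn: "max N M \<le> m" "max N M \<le> n"
    have "vnorm V (vdiff V (vadd V (s m) (t m)) (vadd V (s n) (t n)))
        \<le> vnorm V (vdiff V (s m) (s n)) + vnorm V (vdiff V (t m) (t n))"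
      using s t by (simp add: add_diff_add norm_triangle diff_closed cauchy_seq_closed)
    also have "\<dots> < e / 2 + e / 2"
      using N M mn by (intro add_strict_mono) auto
    finally show "vnorm V (vdiff V (vadd V (s m) (t m)) (vadd V (s n) (t n))) < e" by simp
  qed
qed

lemma cauchy_seq_scale:
  assumes s: "cauchy_seq V s"
  shows "cauchy_seq V (\<lambda>n. vscale V a (s n))"
  unfolding cauchy_seq_def
proof (intro conjI allI impI)
  show "vscale V a (s n) \<in> carr V" for n
    using assms by (simp add: cauchy_seq_closed scale_closed)
  fix e :: real assume "0 < e"
  then have "0 < e / (norm a + 1)" by (intro divide_pos_pos) (auto simp: add_nonneg_pos)
  then obtain N where N: "\<forall>m\<ge>N. \<forall>n\<ge>N. vnorm V (vdiff V (s m) (s n)) < e / (norm a + 1)"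
    using s unfolding cauchy_seq_def by blast
  show "\<exists>N. \<forall>m\<ge>N. \<forall>n\<ge>N. vnorm V (vdiff V (vscale V a (s m)) (vscale V a (s n))) < e"
  proof (intro exI allI impI)
    fix m n assume mn: "N \<le> m" "N \<le> n"
    have "vnorm V (vdiff V (vscale V a (s m)) (vscale V a (s n)))
        = norm a * vnorm V (vdiff V (s m) (s n))"
      using s by (simp add: diff_scale norm_scale diff_closed cauchy_seq_closed)
    also have "\<dots> \<le> (norm a + 1) * vnorm V (vdiff V (s m) (s n))"
      using s by (intro mult_right_mono norm_nonneg diff_closed cauchy_seq_closed) auto
    also have "\<dots> < (norm a + 1) * (e / (norm a + 1))"
      using N mn by (intro mult_strict_left_mono) (auto simp: add_nonneg_pos)
    also have "\<dots> = e"
      using norm_ge_zero[of a] by (simp add: add_nonneg_eq_0_iff)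
    finally show "vnorm V (vdiff V (vscale V a (s m)) (vscale V a (s n))) < e" .
  qed
qed

lemma cauchy_seq_norm_convergent:
  assumes s: "cauchy_seq V s"
  shows "convergent (\<lambda>n. vnorm V (s n))"
proof -
  have "Cauchy (\<lambda>n. vnorm V (s n))"
  proof (rule metric_CauchyI)
    fix e :: real assume "0 < e"
    then obtain N where N: "\<forall>m\<ge>N. \<forall>n\<ge>N. vnorm V (vdiff V (s m) (s n)) < e"
      using s unfolding cauchy_seq_def by blast
    have "dist (vnorm V (s m)) (vnorm V (s n)) < e" if "N \<le> m" "N \<le> n" for m n
    proof -
      have "\<bar>vnorm V (s m) - vnorm V (s n)\<bar> \<le> vnorm V (vdiff V (s m) (s n))"
        using s by (intro abs_norm_diff_le cauchy_seq_closed)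
      also have "\<dots> < e" using N that by blast
      finally show ?thesis by (simp add: dist_real_def)
    qed
    then show "\<exists>N. \<forall>m\<ge>N. \<forall>n\<ge>N. dist (vnorm V (s m)) (vnorm V (s n)) < e" by blast
  qed
  then show ?thesis by (simp add: Cauchy_convergent_iff)
qed

lemma null_equiv_iff:
  "(s, t) \<in> null_equiv V \<longleftrightarrow> cauchy_seq V s \<and> cauchy_seq V t \<and>
     (\<lambda>n. vnorm V (vdiff V (s n) (t n))) \<longlonglongrightarrow> 0"
  by (simp add: null_equiv_def)

lemma equiv_null_equiv: "equiv {s. cauchy_seq V s} (null_equiv V)"
proof (rule equivI)
  show "null_equiv V \<subseteq> {s. cauchy_seq V s} \<times> {s. cauchy_seq V s}"
    by (auto simp: null_equiv_def)
  show "refl_on {s. cauchy_seq V s} (null_equiv V)"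
    by (auto simp: refl_on_def null_equiv_def diff_self cauchy_seq_closed norm_zero)
  show "sym (null_equiv V)"
  proof (rule symI)
    fix s t assume st: "(s, t) \<in> null_equiv V"
    then have "vnorm V (vdiff V (s n) (t n)) = vnorm V (vdiff V (t n) (s n))" for n
      by (intro norm_diff_commute) (auto simp: null_equiv_iff cauchy_seq_closed)
    with st show "(t, s) \<in> null_equiv V" by (simp add: null_equiv_iff)
  qed
  show "trans (null_equiv V)"
  proof (rule transI)
    fix s t u assume st: "(s, t) \<in> null_equiv V" and tu: "(t, u) \<in> null_equiv V"
    then have c: "s n \<in> carr V" "t n \<in> carr V" "u n \<in> carr V" for n
      by (auto simp: null_equiv_iff cauchy_seq_closed)
    have lim: "(\<lambda>n. vnorm V (vdiff V (s n) (t n)) + vnorm V (vdiff V (t n) (u n))) \<longlonglongrightarrow> 0"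
      using tendsto_add[of _ 0 sequentially _ 0] st tu by (auto simp: null_equiv_iff)
    have "(\<lambda>n. vnorm V (vdiff V (s n) (u n))) \<longlonglongrightarrow> 0"
      by (rule tendsto_sandwich[OF _ _ tendsto_const lim])
        (auto intro!: always_eventually norm_nonneg diff_closed norm_diff_triangle c)
    with st tu show "(s, u) \<in> null_equiv V" by (simp add: null_equiv_iff)
  qed
qed

abbreviation cls :: "(nat \<Rightarrow> 'a) \<Rightarrow> (nat \<Rightarrow> 'a) set" where
  "cls s \<equiv> null_equiv V `` {s}"

lemma mem_cls: "cauchy_seq V s \<Longrightarrow> s \<in> cls s"
  using equiv_class_self[OF equiv_null_equiv] by simp

lemma completion_carr: "carr (cauchy_completion V) = {cls s | s. cauchy_seq V s}"
  by (auto simp: cauchy_completion_def quotient_def)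

lemma completion_zero: "vzero (cauchy_completion V) = cls (\<lambda>n. vzero V)"
  by (simp add: cauchy_completion_def)

text \<open>The operations of the completion are unions over all representatives; as the class obtained
  does not depend on them, the union is that single class.\<close>

lemma completion_add:
  assumes s: "cauchy_seq V s" and t: "cauchy_seq V t"
  shows "vadd (cauchy_completion V) (cls s) (cls t) = cls (\<lambda>n. vadd V (s n) (t n))"
proof -
  have eq: "cls (\<lambda>n. vadd V (s' n) (t' n)) = cls (\<lambda>n. vadd V (s n) (t n))"
    if st: "(s, s') \<in> null_equiv V" "(t, t') \<in> null_equiv V" for s' t'
  proof (rule equiv_class_eq[OF equiv_null_equiv, symmetric])
    have c: "cauchy_seq V s'" "cauchy_seq V t'"
      using st by (auto simp: null_equiv_iff)
    have lim: "(\<lambda>n. vnorm V (vdiff V (s n) (s' n)) + vnorm V (vdiff V (t n) (t' n))) \<longlonglongrightarrow> 0"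
      using tendsto_add[of _ 0 sequentially _ 0] st by (auto simp: null_equiv_iff)
    have "(\<lambda>n. vnorm V (vdiff V (vadd V (s n) (t n)) (vadd V (s' n) (t' n)))) \<longlonglongrightarrow> 0"
      by (rule tendsto_sandwich[OF _ _ tendsto_const lim])
        (use s t c in \<open>auto intro!: always_eventually norm_nonneg diff_closed add_closed norm_triangle
            simp: cauchy_seq_closed add_diff_add\<close>)
    then show "(\<lambda>n. vadd V (s n) (t n), \<lambda>n. vadd V (s' n) (t' n)) \<in> null_equiv V"
      using s t c by (simp add: null_equiv_iff cauchy_seq_add)
  qed
  have "vadd (cauchy_completion V) (cls s) (cls t)
      = (\<Union>s'\<in>cls s. \<Union>t'\<in>cls t. cls (\<lambda>n. vadd V (s' n) (t' n)))"
    by (simp add: cauchy_completion_def)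
  also have "\<dots> = (\<Union>s'\<in>cls s. \<Union>t'\<in>cls t. cls (\<lambda>n. vadd V (s n) (t n)))"
    using eq by (intro SUP_cong refl) auto
  finally show ?thesis
    using mem_cls[OF s] mem_cls[OF t] by auto
qed

lemma completion_scale:
  assumes s: "cauchy_seq V s"
  shows "vscale (cauchy_completion V) a (cls s) = cls (\<lambda>n. vscale V a (s n))"
proof -
  have eq: "cls (\<lambda>n. vscale V a (s' n)) = cls (\<lambda>n. vscale V a (s n))"
    if st: "(s, s') \<in> null_equiv V" for s'
  proof (rule equiv_class_eq[OF equiv_null_equiv, symmetric])
    have c: "cauchy_seq V s'"
      using st by (auto simp: null_equiv_iff)
    have "(\<lambda>n. norm a * vnorm V (vdiff V (s n) (s' n))) \<longlonglongrightarrow> norm a * 0"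
      using st by (intro tendsto_mult tendsto_const) (auto simp: null_equiv_iff)
    then have "(\<lambda>n. vnorm V (vdiff V (vscale V a (s n)) (vscale V a (s' n)))) \<longlonglongrightarrow> 0"
      using s c by (simp add: diff_scale norm_scale diff_closed cauchy_seq_closed)
    then show "(\<lambda>n. vscale V a (s n), \<lambda>n. vscale V a (s' n)) \<in> null_equiv V"
      using s c by (simp add: null_equiv_iff cauchy_seq_scale)
  qed
  have "vscale (cauchy_completion V) a (cls s) = (\<Union>s'\<in>cls s. cls (\<lambda>n. vscale V a (s' n)))"
    by (simp add: cauchy_completion_def)
  also have "\<dots> = (\<Union>s'\<in>cls s. cls (\<lambda>n. vscale V a (s n)))"
    using eq by (intro SUP_cong refl) auto
  finally show ?thesis
    using mem_cls[OF s] by auto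
qed

lemma completion_norm:
  assumes s: "cauchy_seq V s"
  shows "vnorm (cauchy_completion V) (cls s) = lim (\<lambda>n. vnorm V (s n))"
proof -
  have eq: "lim (\<lambda>n. vnorm V (s' n)) = lim (\<lambda>n. vnorm V (s n))"
    if st: "(s, s') \<in> null_equiv V" for s'
  proof -
    have c: "cauchy_seq V s'"
      using st by (auto simp: null_equiv_iff)
    have "(\<lambda>n. vnorm V (s n) - vnorm V (s' n)) \<longlonglongrightarrow> 0"
    proof (rule Lim_null_comparison)
      show "(\<lambda>n. vnorm V (vdiff V (s n) (s' n))) \<longlonglongrightarrow> 0"
        using st by (simp add: null_equiv_iff)
      show "\<forall>\<^sub>F n in sequentially. norm (vnorm V (s n) - vnorm V (s' n)) \<le> vnorm V (vdiff V (s n) (s' n))"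
        using s c by (auto intro!: always_eventually abs_norm_diff_le simp: cauchy_seq_closed)
    qed
    moreover have "(\<lambda>n. vnorm V (s n)) \<longlonglongrightarrow> lim (\<lambda>n. vnorm V (s n))"
      using cauchy_seq_norm_convergent[OF s] by (simp add: convergent_LIMSEQ_iff)
    ultimately have "(\<lambda>n. vnorm V (s n) - (vnorm V (s n) - vnorm V (s' n)))
        \<longlonglongrightarrow> lim (\<lambda>n. vnorm V (s n)) - 0"
      by (intro tendsto_diff)
    then show ?thesis by (simp add: limI)
  qed
  define L where "L = lim (\<lambda>n. vnorm V (s n))"
  have "(\<lambda>s. lim (\<lambda>n. vnorm V (s n))) ` cls s = {L}"
    using eq[folded L_def] mem_cls[OF s] by auto
  then show ?thesis
    by (simp add: cauchy_completion_def L_def)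
qed

lemma tendsto_completion_norm:
  assumes "cauchy_seq V s"
  shows "(\<lambda>n. vnorm V (s n)) \<longlonglongrightarrow> vnorm (cauchy_completion V) (cls s)"
  using cauchy_seq_norm_convergent[OF assms]
  by (simp add: completion_norm[OF assms] convergent_LIMSEQ_iff)

lemma to_completion_eq: "to_completion V x = cls (\<lambda>n. x)"
  by (simp add: to_completion_def)

text \<open>The algebraic laws hold termwise on representatives, and the seminorm laws pass to the
  limit.\<close>

lemma completion_seminormed_space: "seminormed_space (cauchy_completion V)"
proof
  let ?W = "cauchy_completion V"
  note cs = cauchy_seq_const cauchy_seq_add cauchy_seq_scale cauchy_seq_closed zero_closed
  fix A B C assume "A \<in> carr ?W" "B \<in> carr ?W" "C \<in> carr ?W"
  then obtain s t u where stu: "A = cls s" "B = cls t" "C = cls u"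
      "cauchy_seq V s" "cauchy_seq V t" "cauchy_seq V u"
    by (auto simp: completion_carr)
  note S = stu completion_carr completion_zero completion_add completion_scale vdiff_def cs
  show "vadd ?W (vadd ?W A B) C = vadd ?W A (vadd ?W B C)"
    by (simp add: S add_assoc)
next
  let ?W = "cauchy_completion V"
  note cs = cauchy_seq_const cauchy_seq_add cauchy_seq_scale cauchy_seq_closed zero_closed
  fix A B assume "A \<in> carr ?W" "B \<in> carr ?W"
  then obtain s t where st: "A = cls s" "B = cls t" "cauchy_seq V s" "cauchy_seq V t"
    by (auto simp: completion_carr)
  note S = st completion_carr completion_zero completion_add completion_scale cs
  show "vadd ?W A B \<in> carr ?W"
    using cauchy_seq_add[OF st(3,4)] by (auto simp: S)
  show "vadd ?W A B = vadd ?W B A"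
    by (simp add: S add_commute)
  show "vscale ?W a (vadd ?W A B) = vadd ?W (vscale ?W a A) (vscale ?W a B)" for a
    by (simp add: S scale_add_right)
  have "(\<lambda>n. vnorm V (vadd V (s n) (t n))) \<longlonglongrightarrow> vnorm ?W (vadd ?W A B)"
    using tendsto_completion_norm[OF cauchy_seq_add[OF st(3,4)]] by (simp add: S)
  moreover have "(\<lambda>n. vnorm V (s n) + vnorm V (t n)) \<longlonglongrightarrow> vnorm ?W A + vnorm ?W B"
    using tendsto_completion_norm st by (intro tendsto_add) auto
  ultimately show "vnorm ?W (vadd ?W A B) \<le> vnorm ?W A + vnorm ?W B"
    by (rule LIMSEQ_le) (use st in \<open>auto intro!: norm_triangle simp: cauchy_seq_closed\<close>)
next
  let ?W = "cauchy_completion V"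
  note cs = cauchy_seq_const cauchy_seq_add cauchy_seq_scale cauchy_seq_closed zero_closed
  show "vzero ?W \<in> carr ?W"
    using cauchy_seq_const[OF zero_closed] by (auto simp: completion_carr completion_zero)
  fix A assume "A \<in> carr ?W"
  then obtain s where s: "A = cls s" "cauchy_seq V s"
    by (auto simp: completion_carr)
  note S = s completion_carr completion_zero completion_add completion_scale cs
  show "vscale ?W a A \<in> carr ?W" for a
    using cauchy_seq_scale[OF s(2), of a] by (auto simp: S)
  show "vadd ?W A (vzero ?W) = A"
    by (simp add: S add_zero)
  show "vdiff ?W A A = vzero ?W"
    using diff_self by (simp add: S vdiff_def)
  show "vscale ?W (a + b) A = vadd ?W (vscale ?W a A) (vscale ?W b A)" for a b
    by (simp add: S scale_add_left)
  show "vscale ?W a (vscale ?W b A) = vscale ?W (a * b) A" for a b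
    by (simp add: S scale_scale)
  show "vscale ?W 1 A = A"
    by (simp add: S scale_one)
  show "0 \<le> vnorm ?W A"
    using tendsto_completion_norm[OF s(2)] unfolding s(1)
    by (rule LIMSEQ_le_const) (use s in \<open>auto intro!: norm_nonneg simp: cauchy_seq_closed\<close>)
  show "vnorm ?W (vscale ?W a A) = norm a * vnorm ?W A" for a
  proof (rule LIMSEQ_unique)
    show "(\<lambda>n. vnorm V (vscale V a (s n))) \<longlonglongrightarrow> vnorm ?W (vscale ?W a A)"
      using tendsto_completion_norm[OF cauchy_seq_scale[OF s(2)]] by (simp add: S)
    show "(\<lambda>n. vnorm V (vscale V a (s n))) \<longlonglongrightarrow> norm a * vnorm ?W A"
      using tendsto_mult[OF tendsto_const tendsto_completion_norm[OF s(2)]] s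
      by (simp add: norm_scale cauchy_seq_closed)
  qed
qed

end

text \<open>The value at a class is read off an arbitrary representative;
  \<open>tendsto_extend_functional\<close> shows that every other one has the same limit.\<close>

definition extend_functional ::
    "('k::{real_normed_field,banach}, 'a) nspace \<Rightarrow> ('a \<Rightarrow> 'k) \<Rightarrow> (nat \<Rightarrow> 'a) set \<Rightarrow> 'k" where
  "extend_functional V f = (\<lambda>A\<in>carr (cauchy_completion V). lim (\<lambda>n. f ((SOME s. s \<in> A) n)))"

context seminormed_space
begin

text \<open>Boundedness turns Cauchy sequences of vectors into Cauchy sequences of scalars, and these
  converge because the scalar field is complete. Equivalent sequences have the same limit.\<close>

lemma tendsto_extend_functional:
  assumes f: "f \<in> carr (dual V)" and s: "cauchy_seq V s"
  shows "(\<lambda>n. f (s n)) \<longlonglongrightarrow> extend_functional V f (cls s)"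
proof -
  obtain C where C: "\<And>x. x \<in> carr V \<Longrightarrow> norm (f x) \<le> C * vnorm V x"
    using f unfolding mem_dual_iff by blast
  define t where "t = (SOME t. t \<in> cls s)"
  have t: "(s, t) \<in> null_equiv V"
    using someI[of "\<lambda>t. t \<in> cls s", OF mem_cls[OF s]] by (simp add: t_def)
  then have ct: "cauchy_seq V t" by (simp add: null_equiv_iff)
  have "Cauchy (\<lambda>n. f (t n))"
  proof (rule metric_CauchyI)
    fix e :: real assume "0 < e"
    then have "0 < e / (\<bar>C\<bar> + 1)" by (intro divide_pos_pos) auto
    then obtain N where N: "\<forall>m\<ge>N. \<forall>n\<ge>N. vnorm V (vdiff V (t m) (t n)) < e / (\<bar>C\<bar> + 1)"
      using ct unfolding cauchy_seq_def by blast
    have "dist (f (t m)) (f (t n)) < e" if "N \<le> m" "N \<le> n" for m n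
    proof -
      let ?d = "vdiff V (t m) (t n)"
      have d: "?d \<in> carr V" using ct by (simp add: diff_closed cauchy_seq_closed)
      have "dist (f (t m)) (f (t n)) = norm (f ?d)"
        using f ct by (simp add: dist_norm dual_diff cauchy_seq_closed)
      also have "\<dots> \<le> C * vnorm V ?d" by (rule C[OF d])
      also have "\<dots> \<le> (\<bar>C\<bar> + 1) * vnorm V ?d"
        by (rule mult_right_mono[OF _ norm_nonneg[OF d]]) simp
      also have "\<dots> < (\<bar>C\<bar> + 1) * (e / (\<bar>C\<bar> + 1))"
        using N that by (intro mult_strict_left_mono) auto
      finally show ?thesis by simp
    qed
    then show "\<exists>N. \<forall>m\<ge>N. \<forall>n\<ge>N. dist (f (t m)) (f (t n)) < e" by blast
  qed
  then have "(\<lambda>n. f (t n)) \<longlonglongrightarrow> lim (\<lambda>n. f (t n))"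
    by (simp add: Cauchy_convergent_iff convergent_LIMSEQ_iff)
  moreover have "(\<lambda>n. f (s n) - f (t n)) \<longlonglongrightarrow> 0"
  proof (rule Lim_null_comparison)
    show "(\<lambda>n. C * vnorm V (vdiff V (s n) (t n))) \<longlonglongrightarrow> 0"
      using t by (auto simp: null_equiv_iff intro: tendsto_mult_right_zero)
    show "\<forall>\<^sub>F n in sequentially. norm (f (s n) - f (t n)) \<le> C * vnorm V (vdiff V (s n) (t n))"
    proof (rule always_eventually, rule allI)
      fix n
      show "norm (f (s n) - f (t n)) \<le> C * vnorm V (vdiff V (s n) (t n))"
        using C[of "vdiff V (s n) (t n)"] s ct f
        by (simp add: dual_diff diff_closed cauchy_seq_closed)
    qed
  qed
  ultimately have "(\<lambda>n. f (t n) + (f (s n) - f (t n))) \<longlonglongrightarrow> lim (\<lambda>n. f (t n)) + 0"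
    by (rule tendsto_add)
  moreover have "extend_functional V f (cls s) = lim (\<lambda>n. f (t n))"
    using s by (auto simp: extend_functional_def completion_carr t_def)
  ultimately show ?thesis by simp
qed

lemma to_completion_closed: "x \<in> carr V \<Longrightarrow> to_completion V x \<in> carr (cauchy_completion V)"
  by (auto simp: completion_carr to_completion_eq intro: cauchy_seq_const)

lemma norm_to_completion:
  "x \<in> carr V \<Longrightarrow> vnorm (cauchy_completion V) (to_completion V x) = vnorm V x"
  by (simp add: to_completion_eq completion_norm cauchy_seq_const)

lemma to_completion_add:
  "x \<in> carr V \<Longrightarrow> y \<in> carr V \<Longrightarrow> to_completion V (vadd V x y)
    = vadd (cauchy_completion V) (to_completion V x) (to_completion V y)"
  by (simp add: to_completion_eq completion_add cauchy_seq_const)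

lemma to_completion_scale:
  "x \<in> carr V \<Longrightarrow> to_completion V (vscale V a x)
    = vscale (cauchy_completion V) a (to_completion V x)"
  by (simp add: to_completion_eq completion_scale cauchy_seq_const)

lemma extend_functional_to_completion:
  assumes "f \<in> carr (dual V)" "x \<in> carr V"
  shows "extend_functional V f (to_completion V x) = f x"
  using tendsto_extend_functional[OF assms(1) cauchy_seq_const[OF assms(2)]]
  by (simp add: to_completion_eq LIMSEQ_const_iff)

text \<open>Density of the original space: a class is the limit of the terms of any of its
  representatives.\<close>

lemma tendsto_to_completion:
  assumes s: "cauchy_seq V s"
  shows "(\<lambda>n. vnorm (cauchy_completion V) (vdiff (cauchy_completion V) (to_completion V (s n)) (cls s)))
    \<longlonglongrightarrow> 0"
proof (rule LIMSEQ_I)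
  let ?W = "cauchy_completion V"
  fix e :: real assume "0 < e"
  then obtain N where N: "\<forall>m\<ge>N. \<forall>n\<ge>N. vnorm V (vdiff V (s m) (s n)) < e / 2"
    using s unfolding cauchy_seq_def by (meson half_gt_zero)
  have "norm (vnorm ?W (vdiff ?W (to_completion V (s n)) (cls s)) - 0) < e" if n: "N \<le> n" for n
  proof -
    have sn: "cauchy_seq V (\<lambda>m. s n)"
      using s by (simp add: cauchy_seq_const cauchy_seq_closed)
    have d: "cauchy_seq V (\<lambda>m. vdiff V (s n) (s m))"
      unfolding vdiff_def by (rule cauchy_seq_add[OF sn cauchy_seq_scale[OF s]])
    have eq: "vdiff ?W (to_completion V (s n)) (cls s) = cls (\<lambda>m. vdiff V (s n) (s m))"
      using s sn by (simp add: to_completion_eq vdiff_def completion_add completion_scale cauchy_seq_scale)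
    have "vnorm ?W (cls (\<lambda>m. vdiff V (s n) (s m))) \<le> e / 2"
      by (rule LIMSEQ_le_const2[OF tendsto_completion_norm[OF d]]) (use N n in \<open>auto intro: less_imp_le\<close>)
    moreover have "0 \<le> vnorm ?W (cls (\<lambda>m. vdiff V (s n) (s m)))"
      by (rule LIMSEQ_le_const[OF tendsto_completion_norm[OF d]])
        (use s in \<open>auto intro!: norm_nonneg diff_closed simp: cauchy_seq_closed\<close>)
    ultimately show ?thesis using \<open>0 < e\<close> by (simp add: eq)
  qed
  then show "\<exists>N. \<forall>n\<ge>N. norm (vnorm ?W (vdiff ?W (to_completion V (s n)) (cls s)) - 0) < e"
    by blast
qed

lemma dual_completion_tendsto:
  assumes g: "g \<in> carr (dual (cauchy_completion V))" and s: "cauchy_seq V s"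
  shows "(\<lambda>n. g (to_completion V (s n))) \<longlonglongrightarrow> g (cls s)"
proof -
  let ?W = "cauchy_completion V"
  interpret W: seminormed_space ?W by (rule completion_seminormed_space)
  have c: "to_completion V (s n) \<in> carr ?W" "cls s \<in> carr ?W" for n
    using s to_completion_closed by (auto simp: completion_carr cauchy_seq_closed)
  obtain C where C: "\<And>A. A \<in> carr ?W \<Longrightarrow> norm (g A) \<le> C * vnorm ?W A"
    using g unfolding mem_dual_iff by blast
  have "(\<lambda>n. g (to_completion V (s n)) - g (cls s)) \<longlonglongrightarrow> 0"
  proof (rule Lim_null_comparison)
    show "(\<lambda>n. C * vnorm ?W (vdiff ?W (to_completion V (s n)) (cls s))) \<longlonglongrightarrow> 0"
      by (rule tendsto_mult_right_zero[OF tendsto_to_completion[OF s]])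
    show "\<forall>\<^sub>F n in sequentially. norm (g (to_completion V (s n)) - g (cls s))
        \<le> C * vnorm ?W (vdiff ?W (to_completion V (s n)) (cls s))"
    proof (rule always_eventually, rule allI)
      fix n
      show "norm (g (to_completion V (s n)) - g (cls s))
        \<le> C * vnorm ?W (vdiff ?W (to_completion V (s n)) (cls s))"
        using C[OF W.diff_closed[OF c]] W.dual_diff[OF g c] by simp
    qed
  qed
  then show ?thesis by (simp add: LIM_zero_iff)
qed

text \<open>The inverse is restriction along the embedding. Injectivity and the lower norm bound hold
  because the extension agrees with the functional on the embedded space, and surjectivity
  (uniqueness of extensions) is density. The upper norm bound is a limit of inequalities.\<close>

proposition isometric_iso_extend_functional:
  "isometric_iso (dual V) (dual (cauchy_completion V)) (extend_functional V)"
proof -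
  let ?W = "cauchy_completion V" and ?E = "extend_functional V"
  interpret W: seminormed_space ?W by (rule completion_seminormed_space)
  have ext: "?E f \<in> extensional (carr ?W)" for f
    by (simp add: extend_functional_def)
  have cls_in: "cls s \<in> carr ?W" if "cauchy_seq V s" for s
    using that by (auto simp: completion_carr)
  have bound: "norm (?E f A) \<le> c * vnorm ?W A"
    if f: "f \<in> carr (dual V)" and c: "\<And>x. x \<in> carr V \<Longrightarrow> norm (f x) \<le> c * vnorm V x"
      and A: "A \<in> carr ?W" for f c A
  proof -
    obtain s where s: "A = cls s" "cauchy_seq V s" using A by (auto simp: completion_carr)
    have "(\<lambda>n. norm (f (s n))) \<longlonglongrightarrow> norm (?E f A)"
      unfolding s(1) by (rule tendsto_norm[OF tendsto_extend_functional[OF f s(2)]])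
    moreover have "(\<lambda>n. c * vnorm V (s n)) \<longlonglongrightarrow> c * vnorm ?W A"
      unfolding s(1) by (rule tendsto_mult[OF tendsto_const tendsto_completion_norm[OF s(2)]])
    ultimately show ?thesis
      by (rule LIMSEQ_le) (use c s in \<open>auto simp: cauchy_seq_closed\<close>)
  qed
  have E_closed: "?E f \<in> carr (dual ?W)" if f: "f \<in> carr (dual V)" for f
    unfolding mem_dual_iff
  proof (intro conjI ballI allI)
    show "?E f \<in> extensional (carr ?W)" by (rule ext)
    show "\<exists>C. \<forall>A\<in>carr ?W. norm (?E f A) \<le> C * vnorm ?W A"
      using bound[OF f dual_norm_bound[OF f]] by blast
    fix A assume "A \<in> carr ?W"
    then obtain s where s: "A = cls s" "cauchy_seq V s" by (auto simp: completion_carr)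
    show "?E f (vscale ?W a A) = a * ?E f A" for a
    proof (rule LIMSEQ_unique)
      show "(\<lambda>n. f (vscale V a (s n))) \<longlonglongrightarrow> ?E f (vscale ?W a A)"
        using tendsto_extend_functional[OF f cauchy_seq_scale[OF s(2)]] by (simp add: s completion_scale)
      show "(\<lambda>n. f (vscale V a (s n))) \<longlonglongrightarrow> a * ?E f A"
        using tendsto_mult[OF tendsto_const tendsto_extend_functional[OF f s(2)], of a] s f
        by (simp add: mem_dual_iff cauchy_seq_closed)
    qed
    fix B assume "B \<in> carr ?W"
    then obtain t where t: "B = cls t" "cauchy_seq V t" by (auto simp: completion_carr)
    show "?E f (vadd ?W A B) = ?E f A + ?E f B"
    proof (rule LIMSEQ_unique)
      show "(\<lambda>n. f (vadd V (s n) (t n))) \<longlonglongrightarrow> ?E f (vadd ?W A B)"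
        using tendsto_extend_functional[OF f cauchy_seq_add[OF s(2) t(2)]]
        by (simp add: s t completion_add)
      show "(\<lambda>n. f (vadd V (s n) (t n))) \<longlonglongrightarrow> ?E f A + ?E f B"
        using tendsto_add[OF tendsto_extend_functional[OF f s(2)] tendsto_extend_functional[OF f t(2)]]
          s t f
        by (simp add: mem_dual_iff cauchy_seq_closed)
    qed
  qed
  have to_E: "?E f (to_completion V x) = f x" if "f \<in> carr (dual V)" "x \<in> carr V" for f x
    using that by (rule extend_functional_to_completion)
  have "bij_betw ?E (carr (dual V)) (carr (dual ?W))"
  proof (rule bij_betwI[where g = "\<lambda>g. \<lambda>x\<in>carr V. g (to_completion V x)"])
    show "?E \<in> carr (dual V) \<rightarrow> carr (dual ?W)" using E_closed by blast
    show R: "(\<lambda>g. \<lambda>x\<in>carr V. g (to_completion V x)) \<in> carr (dual ?W) \<rightarrow> carr (dual V)"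
    proof
      fix g assume g: "g \<in> carr (dual ?W)"
      have "\<exists>C. \<forall>x\<in>carr V. norm (g (to_completion V x)) \<le> C * vnorm V x"
        using W.dual_norm_bound[OF g to_completion_closed] norm_to_completion
        by (intro exI[of _ "vnorm (dual ?W) g"]) simp
      with g show "(\<lambda>x\<in>carr V. g (to_completion V x)) \<in> carr (dual V)"
        by (simp add: mem_dual_iff add_closed scale_closed to_completion_add to_completion_scale
            to_completion_closed)
    qed
    show "(\<lambda>x\<in>carr V. ?E f (to_completion V x)) = f" if f: "f \<in> carr (dual V)" for f
      using f by (intro extensionalityI[of _ "carr V"]) (auto simp: to_E mem_dual_iff)
    fix g assume g: "g \<in> carr (dual ?W)"
    let ?f = "\<lambda>x\<in>carr V. g (to_completion V x)"
    have f: "?f \<in> carr (dual V)" using R g by blast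
    show "?E ?f = g"
    proof (rule extensionalityI[OF ext])
      show "g \<in> extensional (carr ?W)" using g by (simp add: mem_dual_iff)
      fix A assume "A \<in> carr ?W"
      then obtain s where s: "A = cls s" "cauchy_seq V s" by (auto simp: completion_carr)
      have "(\<lambda>n. ?f (s n)) \<longlonglongrightarrow> g A"
        using dual_completion_tendsto[OF g s(2)] s by (simp add: cauchy_seq_closed)
      with tendsto_extend_functional[OF f s(2)] show "?E ?f A = g A"
        unfolding s(1) by (rule LIMSEQ_unique)
    qed
  qed
  moreover have "?E (vadd (dual V) f g) = vadd (dual ?W) (?E f) (?E g)"
    if f: "f \<in> carr (dual V)" and g: "g \<in> carr (dual V)" for f g
  proof (rule extensionalityI[OF ext])
    show "vadd (dual ?W) (?E f) (?E g) \<in> extensional (carr ?W)" by (simp add: dual_simps)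
    fix A assume A: "A \<in> carr ?W"
    then obtain s where s: "A = cls s" "cauchy_seq V s" by (auto simp: completion_carr)
    show "?E (vadd (dual V) f g) A = vadd (dual ?W) (?E f) (?E g) A"
    proof (rule LIMSEQ_unique)
      show "(\<lambda>n. vadd (dual V) f g (s n)) \<longlonglongrightarrow> vadd (dual ?W) (?E f) (?E g) A"
        using tendsto_add[OF tendsto_extend_functional[OF f s(2)] tendsto_extend_functional[OF g s(2)]]
          s A by (simp add: dual_simps cauchy_seq_closed)
      show "(\<lambda>n. vadd (dual V) f g (s n)) \<longlonglongrightarrow> ?E (vadd (dual V) f g) A"
        unfolding s(1)
        by (rule tendsto_extend_functional[OF dual_add_closed[OF f g] s(2)])
    qed
  qed
  moreover have "?E (vscale (dual V) a f) = vscale (dual ?W) a (?E f)"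
    if f: "f \<in> carr (dual V)" for f a
  proof (rule extensionalityI[OF ext])
    show "vscale (dual ?W) a (?E f) \<in> extensional (carr ?W)" by (simp add: dual_simps)
    fix A assume A: "A \<in> carr ?W"
    then obtain s where s: "A = cls s" "cauchy_seq V s" by (auto simp: completion_carr)
    show "?E (vscale (dual V) a f) A = vscale (dual ?W) a (?E f) A"
    proof (rule LIMSEQ_unique)
      show "(\<lambda>n. vscale (dual V) a f (s n)) \<longlonglongrightarrow> vscale (dual ?W) a (?E f) A"
        using tendsto_mult[OF tendsto_const tendsto_extend_functional[OF f s(2)], of a]
          s A by (simp add: dual_simps cauchy_seq_closed)
      show "(\<lambda>n. vscale (dual V) a f (s n)) \<longlonglongrightarrow> ?E (vscale (dual V) a f) A"
        unfolding s(1)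
        by (rule tendsto_extend_functional[OF dual_scale_closed[OF f] s(2)])
    qed
  qed
  moreover have "vnorm (dual ?W) (?E f) = vnorm (dual V) f" if f: "f \<in> carr (dual V)" for f
  proof (rule antisym)
    show "vnorm (dual ?W) (?E f) \<le> vnorm (dual V) f"
      using bound[OF f dual_norm_bound[OF f]] dual_norm_nonneg[OF f]
      by (intro W.dual_norm_le)
    show "vnorm (dual V) f \<le> vnorm (dual ?W) (?E f)"
    proof (rule dual_norm_le[OF _ W.dual_norm_nonneg[OF E_closed[OF f]]])
      fix x assume x: "x \<in> carr V"
      show "norm (f x) \<le> vnorm (dual ?W) (?E f) * vnorm V x"
        using W.dual_norm_bound[OF E_closed[OF f] to_completion_closed[OF x]] x f
        by (simp add: to_E norm_to_completion)
    qed
  qed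
  ultimately show ?thesis
    unfolding isometric_iso_def by blast
qed

end

section \<open>Multilinear maps and elementary tensors\<close>

lemma scalars_simps [simp]:
  "carr scalars = UNIV" "vzero scalars = 0" "vadd scalars = (+)" "vscale scalars = (*)"
  "vnorm scalars = norm"
  by (simp_all add: scalars_def)

lemma multilinear_add:
  assumes "T \<in> multilinear X Z" "x \<in> tuples X" "u \<in> carr (X i)" "v \<in> carr (X i)"
  shows "T (x(i := vadd (X i) u v)) = vadd Z (T (x(i := u))) (T (x(i := v)))"
  using assms by (simp add: multilinear_def)

lemma multilinear_scale:
  assumes "T \<in> multilinear X Z" "x \<in> tuples X" "u \<in> carr (X i)"
  shows "T (x(i := vscale (X i) a u)) = vscale Z a (T (x(i := u)))"
  using assms by (simp add: multilinear_def)

lemma multilinear_closed: "T \<in> multilinear X Z \<Longrightarrow> x \<in> tuples X \<Longrightarrow> T x \<in> carr Z"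
  by (simp add: multilinear_def)

lemma tuples_mem: "x \<in> tuples X \<Longrightarrow> x i \<in> carr (X i)"
  by (simp add: tuples_def Pi_iff)

lemma tuples_upd: "x \<in> tuples X \<Longrightarrow> u \<in> carr (X i) \<Longrightarrow> x(i := u) \<in> tuples X"
  by (simp add: tuples_def Pi_iff)

lemma snoc_mem_tuples: "x \<in> tuples X \<Longrightarrow> y \<in> carr Y \<Longrightarrow> snoc x y \<in> tuples (snoc X Y)"
  by (auto simp: tuples_def Pi_iff split: option.split)

lemma tuples_snocE:
  assumes "w \<in> tuples (snoc X Y)"
  obtains x y where "w = snoc x y" "x \<in> tuples X" "y \<in> carr Y"
proof
  show "w = snoc (w \<circ> Some) (w None)"
    by (auto simp: fun_eq_iff split: option.split)
  show "w \<circ> Some \<in> tuples X"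
    using tuples_mem[OF assms, of "Some i" for i] by (simp add: tuples_def)
  show "w None \<in> carr Y"
    using tuples_mem[OF assms, of None] by simp
qed

lemma snoc_upd_Some: "(snoc x y)(Some i := u) = snoc (x(i := u)) y"
  by (auto simp: fun_eq_iff split: option.split)

lemma snoc_upd_None: "(snoc x y)(None := u) = snoc x u"
  by (auto simp: fun_eq_iff split: option.split)

lemma tensor_simps:
  "vzero (tensor X) = (\<lambda>\<phi>\<in>forms X. 0)"
  "vadd (tensor X) s t = (\<lambda>\<phi>\<in>forms X. s \<phi> + t \<phi>)"
  "vscale (tensor X) a t = (\<lambda>\<phi>\<in>forms X. a * t \<phi>)"
  "vdiff (tensor X) s t = (\<lambda>\<phi>\<in>forms X. s \<phi> - t \<phi>)"
  by (auto simp: tensor_def vdiff_def)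

lemma mem_tensor_iff:
  "t \<in> carr (tensor X) \<longleftrightarrow> (\<exists>(m::nat) c x. (\<forall>j<m. x j \<in> tuples X) \<and>
     t = (\<lambda>\<phi>\<in>forms X. \<Sum>j<m. c j * tens X (x j) \<phi>))"
  by (auto simp: tensor_def)

lemma tens_apply: "\<phi> \<in> forms X \<Longrightarrow> tens X x \<phi> = \<phi> x"
  by (simp add: tens_def)

lemma tensor_extensional: "t \<in> carr (tensor X) \<Longrightarrow> t \<in> extensional (forms X)"
  by (auto simp: mem_tensor_iff)

lemma tens_closed: "x \<in> tuples X \<Longrightarrow> tens X x \<in> carr (tensor X)"
  unfolding mem_tensor_iff
  by (intro exI[of _ 1] exI[of _ "\<lambda>_. 1"] exI[of _ "\<lambda>_. x"]) (auto simp: tens_def)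

lemma tensor_zero_closed: "vzero (tensor X) \<in> carr (tensor X)"
  unfolding mem_tensor_iff by (intro exI[of _ 0]) (simp add: tensor_simps)

lemma tensor_scale_closed:
  assumes "t \<in> carr (tensor X)"
  shows "vscale (tensor X) a t \<in> carr (tensor X)"
proof -
  obtain m :: nat and c x where "\<forall>j<m. x j \<in> tuples X"
      "t = (\<lambda>\<phi>\<in>forms X. \<Sum>j<m. c j * tens X (x j) \<phi>)"
    using assms unfolding mem_tensor_iff by blast
  then show ?thesis
    unfolding mem_tensor_iff tensor_simps
    by (intro exI[of _ m] exI[of _ "\<lambda>j. a * c j"] exI[of _ x])
      (auto simp: sum_distrib_left mult.assoc)
qed

lemma tensor_add_closed:
  assumes "s \<in> carr (tensor X)" "t \<in> carr (tensor X)"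
  shows "vadd (tensor X) s t \<in> carr (tensor X)"
proof -
  obtain m :: nat and c x where s: "\<forall>j<m. x j \<in> tuples X"
      "s = (\<lambda>\<phi>\<in>forms X. \<Sum>j<m. c j * tens X (x j) \<phi>)"
    using assms(1) unfolding mem_tensor_iff by blast
  obtain n :: nat and d y where t: "\<forall>j<n. y j \<in> tuples X"
      "t = (\<lambda>\<phi>\<in>forms X. \<Sum>j<n. d j * tens X (y j) \<phi>)"
    using assms(2) unfolding mem_tensor_iff by blast
  show ?thesis
    unfolding mem_tensor_iff tensor_simps
    by (intro exI[of _ "m + n"] exI[of _ "concat_seq m c d"] exI[of _ "concat_seq m x y"])
      (use s t in \<open>auto simp: sum_lessThan_add concat_seq_def\<close>)
qed

lemma tensor_diff_closed:
  "s \<in> carr (tensor X) \<Longrightarrow> t \<in> carr (tensor X) \<Longrightarrow> vdiff (tensor X) s t \<in> carr (tensor X)"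
  by (simp add: vdiff_def tensor_add_closed tensor_scale_closed)

text \<open>The building steps suffice to compare two linear functionals on the tensor product by their
  values at elementary tensors.\<close>

lemma tensor_induct [consumes 1, case_names zero add]:
  assumes "t \<in> carr (tensor X)" and zero: "P (vzero (tensor X))"
    and add: "\<And>s c x. s \<in> carr (tensor X) \<Longrightarrow> x \<in> tuples X \<Longrightarrow> P s \<Longrightarrow>
      P (vadd (tensor X) s (vscale (tensor X) c (tens X x)))"
  shows "P t"
proof -
  obtain m :: nat and c x where t: "\<forall>j<m. x j \<in> tuples X"
      "t = (\<lambda>\<phi>\<in>forms X. \<Sum>j<m. c j * tens X (x j) \<phi>)"
    using assms(1) unfolding mem_tensor_iff by blast
  define S where "S n = (\<lambda>\<phi>\<in>forms X. \<Sum>j<n. c j * tens X (x j) \<phi>)" for n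
  have "n \<le> m \<Longrightarrow> P (S n)" for n
  proof (induction n)
    case 0
    have "S 0 = vzero (tensor X)" by (auto simp: S_def tensor_simps fun_eq_iff)
    then show ?case using zero by simp
  next
    case (Suc n)
    have "S n \<in> carr (tensor X)"
      unfolding mem_tensor_iff S_def
      by (intro exI[of _ n] exI[of _ c] exI[of _ x]) (use t Suc.prems in auto)
    moreover have "S (Suc n) = vadd (tensor X) (S n) (vscale (tensor X) (c n) (tens X (x n)))"
      by (auto simp: S_def tensor_simps)
    ultimately show ?case using add[of "S n" "x n" "c n"] t Suc by auto
  qed
  then show ?thesis using t by (simp add: S_def)
qed

lemma vsum_tensor: "vsum (tensor X) f k = (\<lambda>\<phi>\<in>forms X. \<Sum>i<k. f i \<phi>)"
  by (induction k) (auto simp: tensor_simps fun_eq_iff)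

lemma tens_upd_add:
  assumes "x \<in> tuples X" "u \<in> carr (X i)" "v \<in> carr (X i)"
  shows "tens X (x(i := vadd (X i) u v)) = vadd (tensor X) (tens X (x(i := u))) (tens X (x(i := v)))"
  using assms by (auto simp: tens_def tensor_simps multilinear_add)

lemma tens_upd_scale:
  assumes "x \<in> tuples X" "u \<in> carr (X i)"
  shows "tens X (x(i := vscale (X i) a u)) = vscale (tensor X) a (tens X (x(i := u)))"
  using assms by (auto simp: tens_def tensor_simps multilinear_scale)

text \<open>
  A scalar multiple of an elementary tensor is again elementary, as one coordinate of the tuple
  absorbs the scalar. Which one is immaterial; \<open>undefined\<close> picks one, as index types are nonempty.
\<close>

definition scale_tuple :: "('i::finite \<Rightarrow> ('k::{real_normed_field,banach}, 'a, 'm) vspace_scheme) \<Rightarrow>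
    'k \<Rightarrow> ('i \<Rightarrow> 'a) \<Rightarrow> 'i \<Rightarrow> 'a" where
  "scale_tuple X a x = (let i = undefined in x(i := vscale (X i) a (x i)))"

lemma form_scale_tuple:
  assumes "\<phi> \<in> forms X" "x \<in> tuples X"
  shows "\<phi> (scale_tuple X a x) = a * \<phi> x"
  using multilinear_scale[OF assms tuples_mem[OF assms(2)], of undefined a]
  by (simp add: scale_tuple_def)

section \<open>Weak Lipschitz norms of finite families\<close>

text \<open>The supremum that occurs both in the tensor norm and in the summing inequality, written in
  terms of tuples instead of points of \<open>\<Sigma>\<close>.\<close>

definition weak_lip_norm :: "real \<Rightarrow> ('i::finite \<Rightarrow> ('k::{real_normed_field,banach}, 'a) nspace) \<Rightarrow>
    nat \<Rightarrow> (nat \<Rightarrow> 'i \<Rightarrow> 'a) \<Rightarrow> (nat \<Rightarrow> 'i \<Rightarrow> 'a) \<Rightarrow> real" where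
  "weak_lip_norm r X k u v =
     (SUP \<phi>\<in>unit_ball (bounded_forms X). (\<Sum>i<k. norm (\<phi> (u i) - \<phi> (v i)) powr r) powr (1 / r))"

text \<open>\<open>z = \<Sum>\<^sub>i (\<otimes>u\<^sub>i - \<otimes>v\<^sub>i) \<otimes> y\<^sub>i\<close>, with both sides evaluated at the forms \<open>\<psi>\<close>.\<close>

definition tensor_rep :: "('i::finite \<Rightarrow> ('k::{real_normed_field,banach}, 'a) nspace) \<Rightarrow>
    ('k, 'a) nspace \<Rightarrow> ((('i option \<Rightarrow> 'a) \<Rightarrow> 'k) \<Rightarrow> 'k) \<Rightarrow>
    nat \<Rightarrow> (nat \<Rightarrow> 'i \<Rightarrow> 'a) \<Rightarrow> (nat \<Rightarrow> 'i \<Rightarrow> 'a) \<Rightarrow> (nat \<Rightarrow> 'a) \<Rightarrow> bool" where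
  "tensor_rep X Y z k u v y \<longleftrightarrow>
     (\<forall>i<k. u i \<in> tuples X \<and> v i \<in> tuples X \<and> y i \<in> carr Y) \<and>
     z = (\<lambda>\<psi>\<in>forms (snoc X Y). \<Sum>i<k. \<psi> (snoc (u i) (y i)) - \<psi> (snoc (v i) (y i)))"

lemma mem_bounded_forms_ball:
  "\<phi> \<in> unit_ball (bounded_forms X) \<longleftrightarrow> \<phi> \<in> forms X \<and>
     (\<exists>C. \<forall>x\<in>tuples X. norm (\<phi> x) \<le> C * (\<Prod>i\<in>UNIV. vnorm (X i) (x i))) \<and>
     (SUP x\<in>(\<Pi> i\<in>UNIV. unit_ball (X i)). norm (\<phi> x)) \<le> 1"
  by (auto simp: unit_ball_def bounded_multilinear_def)

locale seminormed_family =
  fixes X :: "'i::finite \<Rightarrow> ('k::{real_normed_field,banach}, 'a) nspace"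
  assumes seminormed: "\<And>i. seminormed_space (X i)"
begin

lemma scale_tuple_mem: "x \<in> tuples X \<Longrightarrow> scale_tuple X a x \<in> tuples X"
  unfolding scale_tuple_def Let_def
  by (intro tuples_upd seminormed_space.scale_closed[OF seminormed] tuples_mem)

abbreviation zero_tuple :: "'i \<Rightarrow> 'a" where
  "zero_tuple \<equiv> \<lambda>i. vzero (X i)"

lemma zero_tuple_mem: "zero_tuple \<in> tuples X"
  by (simp add: tuples_def seminormed_space.zero_closed[OF seminormed])

lemma form_zero_tuple:
  assumes "\<phi> \<in> forms X"
  shows "\<phi> zero_tuple = 0"
proof -
  have "scale_tuple X 0 zero_tuple = zero_tuple"
    using seminormed_space.scale_zero[OF seminormed seminormed_space.zero_closed[OF seminormed]]
    by (auto simp: scale_tuple_def Let_def)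
  then show ?thesis
    using form_scale_tuple[OF assms zero_tuple_mem, of 0] by simp
qed

lemma form_scale_all:
  assumes phi: "\<phi> \<in> forms X" and x: "x \<in> tuples X"
  shows "\<phi> (\<lambda>i. vscale (X i) (a i) (x i)) = (\<Prod>i\<in>UNIV. a i) * \<phi> x"
proof -
  have "\<phi> (\<lambda>i. if i \<in> A then vscale (X i) (a i) (x i) else x i) = (\<Prod>i\<in>A. a i) * \<phi> x" for A
  proof (induction A rule: finite_induct[OF finite])
    case 1
    show ?case by simp
  next
    case (2 j A)
    define w where "w = (\<lambda>i. if i \<in> A then vscale (X i) (a i) (x i) else x i)"
    have w: "w \<in> tuples X" "w j = x j"
      using x 2 seminormed_space.scale_closed[OF seminormed]
      by (auto simp: w_def tuples_def Pi_iff)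
    have "(\<lambda>i. if i \<in> insert j A then vscale (X i) (a i) (x i) else x i) = w(j := vscale (X j) (a j) (x j))"
      by (auto simp: w_def)
    then show ?case
      using multilinear_scale[OF phi w(1) tuples_mem[OF x], of j "a j"] 2 w(2)
      by (simp add: w_def[symmetric] mult.assoc fun_upd_idem)
  qed
  from this[of UNIV] show ?thesis by simp
qed

text \<open>If no \<open>x\<^sub>i\<close> has seminorm \<open>0\<close>, normalise all coordinates and use multilinearity. If some
  \<open>x\<^sub>i\<close> does, boundedness of \<open>\<phi>\<close> with whatever constant already gives \<open>\<phi>(x) = 0\<close>.\<close>

lemma form_bound:
  assumes phi: "\<phi> \<in> unit_ball (bounded_forms X)" and x: "x \<in> tuples X"
  shows "norm (\<phi> x) \<le> (\<Prod>i\<in>UNIV. vnorm (X i) (x i))"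
proof -
  have form: "\<phi> \<in> forms X" and sup: "(SUP x\<in>(\<Pi> i\<in>UNIV. unit_ball (X i)). norm (\<phi> x)) \<le> 1"
    using phi by (auto simp: mem_bounded_forms_ball)
  obtain C where C: "\<And>x. x \<in> tuples X \<Longrightarrow> norm (\<phi> x) \<le> C * (\<Prod>i\<in>UNIV. vnorm (X i) (x i))"
    using phi unfolding mem_bounded_forms_ball by blast
  have nn: "0 \<le> vnorm (X i) (x i)" if "x \<in> tuples X" for x i
    using seminormed_space.norm_nonneg[OF seminormed tuples_mem[OF that]] .
  show ?thesis
  proof (cases "\<exists>i. vnorm (X i) (x i) = 0")
    case True
    then have "(\<Prod>i\<in>UNIV. vnorm (X i) (x i)) = 0" by (intro prod_zero) auto
    then show ?thesis using C[OF x] by (simp only: mult_zero_right)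
  next
    case False
    define a :: "'i \<Rightarrow> 'k" where "a i = of_real (1 / vnorm (X i) (x i))" for i
    have pos: "0 < vnorm (X i) (x i)" for i using False nn[OF x, of i] by (simp add: less_le)
    define w where "w = (\<lambda>i. vscale (X i) (a i) (x i))"
    have "norm (a i) * vnorm (X i) (x i) = 1" for i
      using pos[of i] by (simp add: a_def norm_divide)
    then have w: "w \<in> (\<Pi> i\<in>UNIV. unit_ball (X i))"
      using tuples_mem[OF x] seminormed_space.scale_closed[OF seminormed]
        seminormed_space.norm_scale[OF seminormed]
      by (auto simp: w_def unit_ball_def)
    have "norm (\<phi> w) \<le> max 0 C" if w: "w \<in> (\<Pi> i\<in>UNIV. unit_ball (X i))" for w
    proof -
      have wt: "w \<in> tuples X" using w by (auto simp: tuples_def unit_ball_def)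
      have P: "0 \<le> (\<Prod>i\<in>UNIV. vnorm (X i) (w i))" "(\<Prod>i\<in>UNIV. vnorm (X i) (w i)) \<le> 1"
        using w nn[OF wt] by (auto simp: unit_ball_def Pi_iff intro!: prod_nonneg prod_le_1)
      have "norm (\<phi> w) \<le> C * (\<Prod>i\<in>UNIV. vnorm (X i) (w i))" by (rule C[OF wt])
      also have "\<dots> \<le> max 0 C * 1" using P by (intro mult_mono) auto
      finally show ?thesis by simp
    qed
    then have "bdd_above ((\<lambda>x. norm (\<phi> x)) ` (\<Pi> i\<in>UNIV. unit_ball (X i)))"
      by (intro bdd_aboveI2)
    then have "norm (\<phi> w) \<le> 1"
      using cSUP_upper[OF w, of "\<lambda>x. norm (\<phi> x)"] sup by linarith
    moreover have "\<phi> w = (\<Prod>i\<in>UNIV. a i) * \<phi> x"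
      unfolding w_def by (rule form_scale_all[OF form x])
    moreover have "norm (\<Prod>i\<in>UNIV. a i) = 1 / (\<Prod>i\<in>UNIV. vnorm (X i) (x i))"
      using nn[OF x] by (simp add: a_def norm_divide prod_dividef flip: prod_norm)
    moreover have "0 < (\<Prod>i\<in>UNIV. vnorm (X i) (x i))"
      using pos by (intro prod_pos) auto
    ultimately show ?thesis
      by (simp add: norm_mult pos_divide_le_eq)
  qed
qed

lemma zero_form_in_ball: "(\<lambda>x\<in>tuples X. 0) \<in> unit_ball (bounded_forms X)"
proof -
  have ne: "zero_tuple \<in> (\<Pi> i\<in>UNIV. unit_ball (X i))"
    using seminormed_space.zero_in_unit_ball[OF seminormed] by auto
  have sub: "(\<Pi> i\<in>UNIV. unit_ball (X i)) \<subseteq> tuples X"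
    by (auto simp: tuples_def unit_ball_def)
  have "(SUP x\<in>(\<Pi> i\<in>UNIV. unit_ball (X i)). norm ((\<lambda>x\<in>tuples X. 0::'k) x)) \<le> 1"
    by (rule cSUP_least) (use ne sub in auto)
  moreover have "(\<lambda>x\<in>tuples X. 0) \<in> forms X"
    using seminormed_space.add_closed[OF seminormed] seminormed_space.scale_closed[OF seminormed]
    by (auto simp: multilinear_def tuples_upd)
  ultimately show ?thesis
    by (auto simp: mem_bounded_forms_ball intro!: exI[of _ 0])
qed

text \<open>All forms in the unit ball obey the same bound on a tuple, so that the supremum is that of a
  bounded set.\<close>

lemma weak_lip_norm_bdd:
  assumes r: "0 < r" and uv: "\<And>i. i < k \<Longrightarrow> u i \<in> tuples X \<and> v i \<in> tuples X"
  shows "bdd_above ((\<lambda>\<phi>. (\<Sum>i<k. norm (\<phi> (u i) - \<phi> (v i)) powr r) powr (1 / r))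
    ` unit_ball (bounded_forms X))"
proof (rule bdd_aboveI2)
  fix \<phi> assume phi: "\<phi> \<in> unit_ball (bounded_forms X)"
  let ?K = "\<lambda>i. (\<Prod>j\<in>UNIV. vnorm (X j) (u i j)) + (\<Prod>j\<in>UNIV. vnorm (X j) (v i j))"
  have "norm (\<phi> (u i) - \<phi> (v i)) \<le> ?K i" if "i < k" for i
    using norm_triangle_ineq4[of "\<phi> (u i)" "\<phi> (v i)"] form_bound[OF phi, of "u i"]
      form_bound[OF phi, of "v i"] uv[OF that] by linarith
  then show "(\<Sum>i<k. norm (\<phi> (u i) - \<phi> (v i)) powr r) powr (1 / r) \<le> (\<Sum>i<k. ?K i powr r) powr (1 / r)"
    using r by (intro powr_mono2 sum_mono sum_nonneg) auto
qed

lemma weak_lip_norm_upper: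
  assumes "0 < r" and "\<And>i. i < k \<Longrightarrow> u i \<in> tuples X \<and> v i \<in> tuples X"
    and "\<phi> \<in> unit_ball (bounded_forms X)"
  shows "(\<Sum>i<k. norm (\<phi> (u i) - \<phi> (v i)) powr r) powr (1 / r) \<le> weak_lip_norm r X k u v"
  unfolding weak_lip_norm_def by (rule cSUP_upper[OF assms(3) weak_lip_norm_bdd[OF assms(1,2)]])

lemma weak_lip_norm_least:
  assumes "\<And>\<phi>. \<phi> \<in> unit_ball (bounded_forms X) \<Longrightarrow>
    (\<Sum>i<k. norm (\<phi> (u i) - \<phi> (v i)) powr r) powr (1 / r) \<le> c"
  shows "weak_lip_norm r X k u v \<le> c"
  unfolding weak_lip_norm_def by (rule cSUP_least) (use zero_form_in_ball assms in auto)

lemma weak_lip_norm_nonneg: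
  assumes "0 < r" and "\<And>i. i < k \<Longrightarrow> u i \<in> tuples X \<and> v i \<in> tuples X"
  shows "0 \<le> weak_lip_norm r X k u v"
  by (rule order_trans[OF powr_ge_zero weak_lip_norm_upper[OF assms zero_form_in_ball]])

lemma weak_lip_norm_scale_le:
  assumes r: "0 < r" and uv: "\<And>i. i < k \<Longrightarrow> u i \<in> tuples X \<and> v i \<in> tuples X" and c: "0 \<le> c"
  shows "weak_lip_norm r X k (\<lambda>i. scale_tuple X (of_real c) (u i)) (\<lambda>i. scale_tuple X (of_real c) (v i))
    \<le> c * weak_lip_norm r X k u v"
proof (rule weak_lip_norm_least)
  fix \<phi> assume phi: "\<phi> \<in> unit_ball (bounded_forms X)"
  then have form: "\<phi> \<in> forms X" by (simp add: mem_bounded_forms_ball)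
  have "norm (\<phi> (scale_tuple X (of_real c) (u i)) - \<phi> (scale_tuple X (of_real c) (v i))) powr r
      = c powr r * norm (\<phi> (u i) - \<phi> (v i)) powr r" if "i < k" for i
    using uv[OF that] c form
    by (simp add: form_scale_tuple norm_mult powr_mult flip: right_diff_distrib)
  then have "(\<Sum>i<k. norm (\<phi> (scale_tuple X (of_real c) (u i)) - \<phi> (scale_tuple X (of_real c) (v i))) powr r)
      = c powr r * (\<Sum>i<k. norm (\<phi> (u i) - \<phi> (v i)) powr r)"
    by (simp add: sum_distrib_left)
  then show "(\<Sum>i<k. norm (\<phi> (scale_tuple X (of_real c) (u i)) - \<phi> (scale_tuple X (of_real c) (v i)))
      powr r) powr (1 / r) \<le> c * weak_lip_norm r X k u v"
    using weak_lip_norm_upper[OF r uv phi] r c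
    by (simp add: powr_mult powr_powr mult_left_mono)
qed

text \<open>The two families are estimated for one and the same form, and their \<open>r\<close>-th power sums add
  up.\<close>

lemma weak_lip_norm_append_le:
  assumes r: "0 < r" and uv: "\<And>i. i < k \<Longrightarrow> u i \<in> tuples X \<and> v i \<in> tuples X"
    and uv': "\<And>i. i < l \<Longrightarrow> u' i \<in> tuples X \<and> v' i \<in> tuples X"
    and pos: "0 < \<alpha>" "0 < \<beta>"
    and a: "weak_lip_norm r X k u v \<le> \<alpha> powr (1 / r)"
    and b: "weak_lip_norm r X l u' v' \<le> \<beta> powr (1 / r)"
  shows "weak_lip_norm r X (k + l) (concat_seq k u u') (concat_seq k v v') \<le> (\<alpha> + \<beta>) powr (1 / r)"
proof (rule weak_lip_norm_least)
  fix \<phi> assume phi: "\<phi> \<in> unit_ball (bounded_forms X)"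
  have le: "s \<le> \<gamma>" if "s powr (1 / r) \<le> \<gamma> powr (1 / r)" "0 < \<gamma>" for s \<gamma> :: real
    using that r powr_less_mono2[of "1/r" \<gamma> s] by force
  have "(\<Sum>i<k. norm (\<phi> (u i) - \<phi> (v i)) powr r) \<le> \<alpha>"
    by (rule le[OF order_trans[OF weak_lip_norm_upper[OF r uv phi] a] pos(1)])
  moreover have "(\<Sum>i<l. norm (\<phi> (u' i) - \<phi> (v' i)) powr r) \<le> \<beta>"
    by (rule le[OF order_trans[OF weak_lip_norm_upper[OF r uv' phi] b] pos(2)])
  moreover have "(\<Sum>i<k+l. norm (\<phi> (concat_seq k u u' i) - \<phi> (concat_seq k v v' i)) powr r)
      = (\<Sum>i<k. norm (\<phi> (u i) - \<phi> (v i)) powr r) + (\<Sum>i<l. norm (\<phi> (u' i) - \<phi> (v' i)) powr r)"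
    by (simp add: sum_lessThan_add concat_seq_def)
  ultimately show "(\<Sum>i<k+l. norm (\<phi> (concat_seq k u u' i) - \<phi> (concat_seq k v v' i)) powr r) powr (1 / r)
      \<le> (\<alpha> + \<beta>) powr (1 / r)"
    using r by (intro powr_mono2 add_nonneg_nonneg sum_nonneg) (auto intro!: add_nonneg_nonneg sum_nonneg)
qed

end

section \<open>The tensor norm\<close>

locale lip_tensor_product = seminormed_family X
  for X :: "'i::finite \<Rightarrow> ('k::{real_normed_field,banach}, 'a) nspace" +
  fixes Y :: "('k, 'a) nspace" and p :: ereal and r :: real
  assumes seminormed_Y: "seminormed_space Y"
    and p_gt_1: "1 < p" and conjugate: "1 / p + 1 / ereal r = 1"
begin

sublocale Y: seminormed_space Y by (rule seminormed_Y)

lemma r_pos: "0 < r"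
  using p_gt_1 conjugate by (cases rule: conjugate_exponent_cases) auto

lemma form_fix_last_mem:
  assumes "\<psi> \<in> forms (snoc X Y)" "y \<in> carr Y"
  shows "(\<lambda>x\<in>tuples X. \<psi> (snoc x y)) \<in> forms X"
  by (rule form_fix_last[OF assms seminormed_space.add_closed[OF seminormed]
        seminormed_space.scale_closed[OF seminormed]])

lemma form_snoc_zero_tuple:
  assumes "\<psi> \<in> forms (snoc X Y)" "y \<in> carr Y"
  shows "\<psi> (snoc zero_tuple y) = 0"
  using form_zero_tuple[OF form_fix_last_mem[OF assms]] by (simp add: zero_tuple_mem)

lemma form_snoc_scale_tuple:
  assumes "\<psi> \<in> forms (snoc X Y)" "x \<in> tuples X" "y \<in> carr Y"
  shows "\<psi> (snoc (scale_tuple X a x) y) = a * \<psi> (snoc x y)"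
  using form_scale_tuple[OF form_fix_last_mem[OF assms(1,3)] assms(2)] assms(2)
  by (simp add: scale_tuple_mem)

lemma form_snoc_scale_last:
  assumes "\<psi> \<in> forms (snoc X Y)" "x \<in> tuples X" "y \<in> carr Y"
  shows "\<psi> (snoc x (vscale Y a y)) = a * \<psi> (snoc x y)"
  using multilinear_scale[OF assms(1) snoc_mem_tuples[OF assms(2,3)], of y None a] assms(3)
  by (simp add: snoc_upd_None)

lemma tens_last_diff:
  assumes "u \<in> tuples X" "v \<in> tuples X" "y \<in> carr Y"
  shows "tens_last X Y (vdiff (tensor X) (tens X u) (tens X v)) y
    = (\<lambda>\<psi>\<in>forms (snoc X Y). \<psi> (snoc u y) - \<psi> (snoc v y))"
  using assms form_fix_last_mem[OF _ assms(3)]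
  by (auto simp: tens_last_def tensor_simps tens_apply fun_eq_iff)

text \<open>Points of \<open>\<Sigma>\<close> are elementary tensors, and a form viewed as a function on \<open>\<Sigma>\<close> takes at such a
  point its value at the tuple. Hence the infimum may be taken over families of tuples, which is the
  form of the tensor norm used from here on.\<close>

lemma d_Lip_eq:
  "d_Lip p r X Y z = Inf {weak_lip_norm r X k u v * lp_norm p k (\<lambda>i. vnorm Y (y i)) | k u v y.
     tensor_rep X Y z k u v y}"
  (is "_ = Inf ?B")
proof -
  let ?cost = "\<lambda>k P Q. SUP f\<in>on_Sigma X ` unit_ball (bounded_forms X).
    (\<Sum>i<k. norm (f (P i) - f (Q i)) powr r) powr (1 / r)"
  let ?A = "{?cost k P Q * lp_norm p k (\<lambda>i. vnorm Y (y i)) | k P Q y.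
     (\<forall>i<k. P i \<in> Sigma_tens X \<and> Q i \<in> Sigma_tens X \<and> y i \<in> carr Y) \<and>
     z = vsum (tensor (snoc X Y)) (\<lambda>i. tens_last X Y (vdiff (tensor X) (P i) (Q i)) (y i)) k}"
  have cost: "?cost k P Q = weak_lip_norm r X k u v"
    if "\<forall>i<k. u i \<in> tuples X \<and> v i \<in> tuples X \<and> P i = tens X (u i) \<and> Q i = tens X (v i)"
    for k :: nat and P Q u v
  proof -
    have "?cost k P Q = (SUP \<phi>\<in>unit_ball (bounded_forms X).
        (\<Sum>i<k. norm (on_Sigma X \<phi> (P i) - on_Sigma X \<phi> (Q i)) powr r) powr (1 / r))"
      by (simp add: image_image)
    also have "\<dots> = weak_lip_norm r X k u v"
      unfolding weak_lip_norm_def using that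
      by (intro SUP_cong refl arg_cong2[where f = "(powr)"] sum.cong)
        (auto simp: on_Sigma_tens mem_bounded_forms_ball)
    finally show ?thesis .
  qed
  have rep: "vsum (tensor (snoc X Y)) (\<lambda>i. tens_last X Y (vdiff (tensor X) (P i) (Q i)) (y i)) k
      = (\<lambda>\<psi>\<in>forms (snoc X Y). \<Sum>i<k. \<psi> (snoc (u i) (y i)) - \<psi> (snoc (v i) (y i)))"
    if "\<forall>i<k. u i \<in> tuples X \<and> v i \<in> tuples X \<and> P i = tens X (u i) \<and> Q i = tens X (v i)"
      and "\<forall>i<k. y i \<in> carr Y"
    for k :: nat and P Q u v y
    using that by (simp add: vsum_tensor tens_last_diff cong: restrict_cong)
  have "?A = ?B"
  proof (intro equalityI subsetI)
    fix c assume "c \<in> ?A"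
    then obtain k P Q y where c: "c = ?cost k P Q * lp_norm p k (\<lambda>i. vnorm Y (y i))"
      and PQ: "\<forall>i<k. P i \<in> Sigma_tens X \<and> Q i \<in> Sigma_tens X \<and> y i \<in> carr Y"
      and z: "z = vsum (tensor (snoc X Y)) (\<lambda>i. tens_last X Y (vdiff (tensor X) (P i) (Q i)) (y i)) k"
      by blast
    define u where "u i = (SOME x. x \<in> tuples X \<and> P i = tens X x)" for i
    define v where "v i = (SOME x. x \<in> tuples X \<and> Q i = tens X x)" for i
    have uv: "\<forall>i<k. u i \<in> tuples X \<and> v i \<in> tuples X \<and> P i = tens X (u i) \<and> Q i = tens X (v i)"
    proof (intro allI impI)
      fix i assume "i < k"
      then have "\<exists>x. x \<in> tuples X \<and> P i = tens X x" "\<exists>x. x \<in> tuples X \<and> Q i = tens X x"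
        using PQ by (auto simp: Sigma_tens_def)
      from this[THEN someI_ex]
      show "u i \<in> tuples X \<and> v i \<in> tuples X \<and> P i = tens X (u i) \<and> Q i = tens X (v i)"
        by (simp add: u_def v_def)
    qed
    show "c \<in> ?B"
      unfolding c cost[OF uv] using rep[OF uv, of y] uv PQ z
      by (intro CollectI exI[of _ k] exI[of _ u] exI[of _ v] exI[of _ y]) (auto simp: tensor_rep_def)
  next
    fix c assume "c \<in> ?B"
    then obtain k u v y where c: "c = weak_lip_norm r X k u v * lp_norm p k (\<lambda>i. vnorm Y (y i))"
      and R: "tensor_rep X Y z k u v y"
      by blast
    let ?P = "\<lambda>i. tens X (u i)" and ?Q = "\<lambda>i. tens X (v i)"
    have uv: "\<forall>i<k. u i \<in> tuples X \<and> v i \<in> tuples X \<and> ?P i = tens X (u i) \<and> ?Q i = tens X (v i)"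
      using R by (simp add: tensor_rep_def)
    show "c \<in> ?A"
      unfolding c cost[OF uv, symmetric] using rep[OF uv, of y] R
      by (intro CollectI exI[of _ k] exI[of _ ?P] exI[of _ ?Q] exI[of _ y])
        (auto simp: tensor_rep_def Sigma_tens_def)
  qed
  then show ?thesis
    unfolding d_Lip_def by simp
qed

lemma tensor_rep_mem:
  "tensor_rep X Y z k u v y \<Longrightarrow> i < k \<Longrightarrow> u i \<in> tuples X \<and> v i \<in> tuples X"
  by (simp add: tensor_rep_def)

lemma tensor_rep_apply:
  "tensor_rep X Y z k u v y \<Longrightarrow> \<psi> \<in> forms (snoc X Y) \<Longrightarrow>
    z \<psi> = (\<Sum>i<k. \<psi> (snoc (u i) (y i)) - \<psi> (snoc (v i) (y i)))"
  by (simp add: tensor_rep_def)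

lemma tensor_rep_cost_nonneg:
  assumes "tensor_rep X Y z k u v y"
  shows "0 \<le> weak_lip_norm r X k u v * lp_norm p k (\<lambda>i. vnorm Y (y i))"
  using weak_lip_norm_nonneg[OF r_pos tensor_rep_mem[OF assms]] lp_norm_nonneg by simp

text \<open>Every elementary tensor is a difference of elementary tensors, the second one being \<open>0\<close>;
  coefficients move into the last factor.\<close>

lemma tensor_rep_exists:
  assumes "z \<in> carr (tensor (snoc X Y))"
  shows "\<exists>k u v y. tensor_rep X Y z k u v y"
proof -
  obtain m :: nat and c w where w: "\<forall>j<m. w j \<in> tuples (snoc X Y)"
      "z = (\<lambda>\<psi>\<in>forms (snoc X Y). \<Sum>j<m. c j * tens (snoc X Y) (w j) \<psi>)"
    using assms unfolding mem_tensor_iff by blast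
  define x where "x j = w j \<circ> Some" for j
  define y where "y j = w j None" for j
  have xy: "w j = snoc (x j) (y j)" "x j \<in> tuples X" "y j \<in> carr Y" if j: "j < m" for j
  proof -
    obtain x' y' where "w j = snoc x' y'" "x' \<in> tuples X" "y' \<in> carr Y"
      using w(1) j tuples_snocE by blast
    then show "w j = snoc (x j) (y j)" "x j \<in> tuples X" "y j \<in> carr Y"
      by (auto simp: x_def y_def o_def)
  qed
  have "tensor_rep X Y z m x (\<lambda>j. zero_tuple) (\<lambda>j. vscale Y (c j) (y j))"
    unfolding tensor_rep_def
  proof (intro conjI allI impI)
    show "z = (\<lambda>\<psi>\<in>forms (snoc X Y). \<Sum>i<m. \<psi> (snoc (x i) (vscale Y (c i) (y i)))
        - \<psi> (snoc zero_tuple (vscale Y (c i) (y i))))"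
      unfolding w(2)
      by (intro restrict_ext sum.cong refl)
        (simp add: tens_apply xy form_snoc_scale_last form_snoc_zero_tuple Y.scale_closed)
  qed (auto simp: xy zero_tuple_mem Y.scale_closed)
  then show ?thesis by blast
qed

lemma d_Lip_upper:
  assumes "tensor_rep X Y z k u v y"
  shows "d_Lip p r X Y z \<le> weak_lip_norm r X k u v * lp_norm p k (\<lambda>i. vnorm Y (y i))"
  unfolding d_Lip_eq
  by (rule cInf_lower) (use assms tensor_rep_cost_nonneg in \<open>auto intro!: bdd_belowI[of _ 0]\<close>)

lemma d_Lip_greatest:
  assumes "z \<in> carr (tensor (snoc X Y))"
    and "\<And>k u v y. tensor_rep X Y z k u v y \<Longrightarrow>
      c \<le> weak_lip_norm r X k u v * lp_norm p k (\<lambda>i. vnorm Y (y i))"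
  shows "c \<le> d_Lip p r X Y z"
  unfolding d_Lip_eq
  by (rule cInf_greatest) (use assms tensor_rep_exists[OF assms(1)] in auto)

lemma d_Lip_nonneg: "z \<in> carr (tensor (snoc X Y)) \<Longrightarrow> 0 \<le> d_Lip p r X Y z"
  by (rule d_Lip_greatest) (auto intro: tensor_rep_cost_nonneg)

lemma d_Lip_approx:
  assumes "z \<in> carr (tensor (snoc X Y))" and "d_Lip p r X Y z < a"
  obtains k u v y where "tensor_rep X Y z k u v y"
    "weak_lip_norm r X k u v * lp_norm p k (\<lambda>i. vnorm Y (y i)) < a"
proof -
  have "\<not> (\<forall>k u v y. tensor_rep X Y z k u v y \<longrightarrow>
      a \<le> weak_lip_norm r X k u v * lp_norm p k (\<lambda>i. vnorm Y (y i)))"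
    using d_Lip_greatest[OF assms(1), of a] assms(2) by force
  then show ?thesis using that by force
qed

text \<open>Scaling the last factors of a representation of \<open>z\<close> gives one of \<open>a z\<close>. The reverse
  inequality follows with the inverse scalar.\<close>

lemma d_Lip_scale_le:
  assumes z: "z \<in> carr (tensor (snoc X Y))"
  shows "d_Lip p r X Y (vscale (tensor (snoc X Y)) a z) \<le> norm a * d_Lip p r X Y z"
proof -
  let ?az = "vscale (tensor (snoc X Y)) a z"
  have az: "?az \<in> carr (tensor (snoc X Y))" using z by (rule tensor_scale_closed)
  have le: "d_Lip p r X Y ?az \<le> norm a * (weak_lip_norm r X k u v * lp_norm p k (\<lambda>i. vnorm Y (y i)))"
    if R: "tensor_rep X Y z k u v y" for k u v y
  proof -
    have R': "tensor_rep X Y ?az k u v (\<lambda>i. vscale Y a (y i))"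
      using R unfolding tensor_rep_def
      by (auto simp: tensor_simps Y.scale_closed sum_distrib_left right_diff_distrib
          form_snoc_scale_last fun_eq_iff intro!: sum.cong)
    have "lp_norm p k (\<lambda>i. vnorm Y (vscale Y a (y i))) \<le> lp_norm p k (\<lambda>i. norm a * vnorm Y (y i))"
      using R by (intro lp_norm_mono p_gt_1) (simp add: tensor_rep_def Y.norm_scale)
    also have "\<dots> \<le> norm a * lp_norm p k (\<lambda>i. vnorm Y (y i))"
      by (intro lp_norm_scale p_gt_1) simp
    finally have "weak_lip_norm r X k u v * lp_norm p k (\<lambda>i. vnorm Y (vscale Y a (y i)))
        \<le> weak_lip_norm r X k u v * (norm a * lp_norm p k (\<lambda>i. vnorm Y (y i)))"
      by (rule mult_left_mono) (rule weak_lip_norm_nonneg[OF r_pos tensor_rep_mem[OF R]])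
    with d_Lip_upper[OF R'] show ?thesis by (simp add: mult.left_commute)
  qed
  show ?thesis
  proof (cases "a = 0")
    case True
    then show ?thesis
      using le tensor_rep_exists[OF z] by auto
  next
    case False
    then have "d_Lip p r X Y ?az / norm a \<le> d_Lip p r X Y z"
      using le by (intro d_Lip_greatest[OF z]) (simp add: divide_le_eq mult.commute)
    then show ?thesis using False by (simp add: divide_le_eq mult.commute)
  qed
qed

lemma d_Lip_scale:
  assumes z: "z \<in> carr (tensor (snoc X Y))"
  shows "d_Lip p r X Y (vscale (tensor (snoc X Y)) a z) = norm a * d_Lip p r X Y z"
proof (rule antisym[OF d_Lip_scale_le[OF z]])
  let ?T = "tensor (snoc X Y)"
  show "norm a * d_Lip p r X Y z \<le> d_Lip p r X Y (vscale ?T a z)"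
  proof (cases "a = 0")
    case True
    then show ?thesis using d_Lip_nonneg[OF tensor_scale_closed[OF z]] by simp
  next
    case False
    have "vscale ?T (inverse a) (vscale ?T a z) = z"
      using False tensor_extensional[OF z]
      by (auto simp: tensor_simps fun_eq_iff extensional_def restrict_def)
    then have "d_Lip p r X Y z \<le> norm (inverse a) * d_Lip p r X Y (vscale ?T a z)"
      using d_Lip_scale_le[OF tensor_scale_closed[OF z], of "inverse a"] by metis
    then have "d_Lip p r X Y z \<le> d_Lip p r X Y (vscale ?T a z) / norm a"
      by (simp add: norm_inverse divide_inverse mult.commute)
    then show ?thesis
      using False by (simp add: pos_le_divide_eq mult.commute)
  qed
qed

text \<open>Replacing \<open>u\<close>, \<open>v\<close>, \<open>y\<close> by \<open>c u\<close>, \<open>c v\<close>, \<open>y / c\<close> represents the same tensor at the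
  same cost, but shifts the weight between the two factors of the cost. As their product is less than
  \<open>a = a\<^sup>1\<^sup>/\<^sup>r a\<^sup>1\<^sup>-\<^sup>1\<^sup>/\<^sup>r\<close>, some \<open>c\<close> brings each factor below its share of \<open>a\<close>.\<close>

lemma balanced_rep:
  assumes z: "z \<in> carr (tensor (snoc X Y))" and a: "d_Lip p r X Y z < a"
  obtains k u v y where "tensor_rep X Y z k u v y" "weak_lip_norm r X k u v \<le> a powr (1 / r)"
    "lp_norm p k (\<lambda>i. vnorm Y (y i)) \<le> a powr (1 - 1 / r)"
proof -
  obtain k u v y where R: "tensor_rep X Y z k u v y"
    and lt: "weak_lip_norm r X k u v * lp_norm p k (\<lambda>i. vnorm Y (y i)) < a"
    using d_Lip_approx[OF z a] by blast
  define A where "A = weak_lip_norm r X k u v"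
  define B where "B = lp_norm p k (\<lambda>i. vnorm Y (y i))"
  have A: "0 \<le> A" unfolding A_def by (rule weak_lip_norm_nonneg[OF r_pos tensor_rep_mem[OF R]])
  have B: "0 \<le> B" unfolding B_def by (rule lp_norm_nonneg)
  have AB: "A * B < a" using lt by (simp add: A_def B_def)
  have a0: "0 < a" using A B AB by (meson mult_nonneg_nonneg order_le_less_trans)
  have "\<exists>c>0. c * A \<le> a powr (1 / r) \<and> B / c \<le> a powr (1 - 1 / r)"
  proof (cases "B = 0")
    case True
    \<comment> \<open>The second factor vanishes, so any small \<open>c\<close> works; \<open>A + 1\<close> guards against \<open>A = 0\<close>.\<close>
    have "a powr (1 / r) / (A + 1) * A \<le> a powr (1 / r)"
      using A by (simp add: divide_le_eq mult_left_mono)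
    then show ?thesis
      using A a0 True by (intro exI[of _ "a powr (1 / r) / (A + 1)"]) auto
  next
    case False
    define c where "c = B / a powr (1 - 1 / r)"
    have "c * A = (A * B) / a powr (1 - 1 / r)" by (simp add: c_def)
    also have "\<dots> \<le> a / a powr (1 - 1 / r)" using AB by (intro divide_right_mono) auto
    also have "\<dots> = a powr (1 / r)" using a0 powr_diff[of a 1 "1 - 1 / r"] by simp
    finally show ?thesis
      using False B a0 by (intro exI[of _ c]) (simp add: c_def)
  qed
  then obtain c where c: "0 < c" "c * A \<le> a powr (1 / r)" "B / c \<le> a powr (1 - 1 / r)" by blast
  let ?u = "\<lambda>i. scale_tuple X (of_real c) (u i)" and ?v = "\<lambda>i. scale_tuple X (of_real c) (v i)"
  let ?y = "\<lambda>i. vscale Y (of_real (1 / c)) (y i)"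
  have "tensor_rep X Y z k ?u ?v ?y"
    using R c(1) unfolding tensor_rep_def
    by (auto simp: scale_tuple_mem Y.scale_closed form_snoc_scale_tuple form_snoc_scale_last
        fun_eq_iff intro!: sum.cong)
  moreover have "weak_lip_norm r X k ?u ?v \<le> a powr (1 / r)"
    by (rule order_trans[OF weak_lip_norm_scale_le[OF r_pos tensor_rep_mem[OF R] less_imp_le[OF c(1)]]
          c(2)[unfolded A_def]])
  moreover have "lp_norm p k (\<lambda>i. vnorm Y (?y i)) \<le> a powr (1 - 1 / r)"
  proof -
    have "lp_norm p k (\<lambda>i. vnorm Y (?y i)) \<le> lp_norm p k (\<lambda>i. 1 / c * vnorm Y (y i))"
      using R c by (intro lp_norm_mono p_gt_1) (simp add: tensor_rep_def Y.norm_scale norm_divide)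
    also have "\<dots> \<le> 1 / c * B"
      unfolding B_def using c by (intro lp_norm_scale p_gt_1) simp
    finally show ?thesis using c(3) by simp
  qed
  ultimately show ?thesis by (rule that)
qed

text \<open>Concatenating balanced representations of cost below \<open>\<alpha>\<close> and \<open>\<beta>\<close> gives the factors
  \<open>(\<alpha> + \<beta>)\<^sup>1\<^sup>/\<^sup>r\<close> and \<open>(\<alpha> + \<beta>)\<^sup>1\<^sup>-\<^sup>1\<^sup>/\<^sup>r\<close>, whose product is \<open>\<alpha> + \<beta>\<close>.\<close>

lemma d_Lip_triangle:
  assumes s: "s \<in> carr (tensor (snoc X Y))" and t: "t \<in> carr (tensor (snoc X Y))"
  shows "d_Lip p r X Y (vadd (tensor (snoc X Y)) s t) \<le> d_Lip p r X Y s + d_Lip p r X Y t"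
proof (rule field_le_epsilon)
  fix e :: real assume e: "0 < e"
  define \<alpha> where "\<alpha> = d_Lip p r X Y s + e / 2"
  define \<beta> where "\<beta> = d_Lip p r X Y t + e / 2"
  have ab: "d_Lip p r X Y s < \<alpha>" "d_Lip p r X Y t < \<beta>" "0 < \<alpha>" "0 < \<beta>"
    using e d_Lip_nonneg[OF s] d_Lip_nonneg[OF t] by (auto simp: \<alpha>_def \<beta>_def)
  obtain k u v y where R: "tensor_rep X Y s k u v y" "weak_lip_norm r X k u v \<le> \<alpha> powr (1 / r)"
    "lp_norm p k (\<lambda>i. vnorm Y (y i)) \<le> \<alpha> powr (1 - 1 / r)"
    using balanced_rep[OF s ab(1)] by blast
  obtain l u' v' y' where R': "tensor_rep X Y t l u' v' y'" "weak_lip_norm r X l u' v' \<le> \<beta> powr (1 / r)"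
    "lp_norm p l (\<lambda>i. vnorm Y (y' i)) \<le> \<beta> powr (1 - 1 / r)"
    using balanced_rep[OF t ab(2)] by blast
  let ?U = "concat_seq k u u'" and ?V = "concat_seq k v v'" and ?W = "concat_seq k y y'"
  have "tensor_rep X Y (vadd (tensor (snoc X Y)) s t) (k + l) ?U ?V ?W"
    using R(1) R'(1) unfolding tensor_rep_def
    by (auto simp: tensor_simps fun_eq_iff sum_lessThan_add concat_seq_def)
  then have "d_Lip p r X Y (vadd (tensor (snoc X Y)) s t)
      \<le> weak_lip_norm r X (k + l) ?U ?V * lp_norm p (k + l) (\<lambda>i. vnorm Y (?W i))"
    by (rule d_Lip_upper)
  also have "(\<lambda>i. vnorm Y (?W i)) = concat_seq k (\<lambda>i. vnorm Y (y i)) (\<lambda>i. vnorm Y (y' i))"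
    by (auto simp: concat_seq_def)
  also have "weak_lip_norm r X (k + l) ?U ?V * lp_norm p (k + l) (concat_seq k (\<lambda>i. vnorm Y (y i)) (\<lambda>i. vnorm Y (y' i)))
      \<le> (\<alpha> + \<beta>) powr (1 / r) * (\<alpha> + \<beta>) powr (1 - 1 / r)"
    by (intro mult_mono lp_norm_nonneg powr_ge_zero
        weak_lip_norm_append_le[OF r_pos tensor_rep_mem[OF R(1)] tensor_rep_mem[OF R'(1)] ab(3,4) R(2) R'(2)]
        lp_norm_append_le[OF p_gt_1 conjugate ab(3,4) R(3) R'(3)])
  also have "\<dots> = \<alpha> + \<beta>"
    using ab by (simp flip: powr_add)
  finally show "d_Lip p r X Y (vadd (tensor (snoc X Y)) s t) \<le> d_Lip p r X Y s + d_Lip p r X Y t + e"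
    by (simp add: \<alpha>_def \<beta>_def)
qed

lemma seminormed_lip_tensor: "seminormed_space (lip_tensor p r X Y)"
proof
  let ?T = "tensor (snoc X Y)"
  note [simp] = tensor_simps tensor_extensional
  fix s t z and a b :: 'k
  { assume "s \<in> carr (lip_tensor p r X Y)"
    then have s: "s \<in> carr ?T" by simp
    have ex: "(\<lambda>\<psi>\<in>forms (snoc X Y). s \<psi>) = s"
      by (rule extensional_restrict[OF tensor_extensional[OF s]])
    have sD: "vdiff (lip_tensor p r X Y) s s = vdiff ?T s s" by (simp add: vdiff_def)
    show "vscale (lip_tensor p r X Y) a s \<in> carr (lip_tensor p r X Y)"
      using tensor_scale_closed[OF s] by simp
    show "vadd (lip_tensor p r X Y) s (vzero (lip_tensor p r X Y)) = s"
      using ex by (simp cong: restrict_cong)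
    show "vdiff (lip_tensor p r X Y) s s = vzero (lip_tensor p r X Y)"
      unfolding sD by simp
    show "vscale (lip_tensor p r X Y) (a + b) s
        = vadd (lip_tensor p r X Y) (vscale (lip_tensor p r X Y) a s) (vscale (lip_tensor p r X Y) b s)"
      by (auto simp: distrib_right)
    show "vscale (lip_tensor p r X Y) a (vscale (lip_tensor p r X Y) b s) = vscale (lip_tensor p r X Y) (a * b) s"
      by (auto simp: mult.assoc)
    show "vscale (lip_tensor p r X Y) 1 s = s"
      using ex by simp
    show "0 \<le> vnorm (lip_tensor p r X Y) s"
      using d_Lip_nonneg[OF s] by simp
    show "vnorm (lip_tensor p r X Y) (vscale (lip_tensor p r X Y) a s) = norm a * vnorm (lip_tensor p r X Y) s"
      using d_Lip_scale[OF s] by (simp del: tensor_simps)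
    assume "t \<in> carr (lip_tensor p r X Y)"
    then have t: "t \<in> carr ?T" by simp
    show "vadd (lip_tensor p r X Y) s t \<in> carr (lip_tensor p r X Y)"
      using tensor_add_closed[OF s t] by simp
    show "vadd (lip_tensor p r X Y) s t = vadd (lip_tensor p r X Y) t s"
      by (auto simp: add.commute)
    show "vscale (lip_tensor p r X Y) a (vadd (lip_tensor p r X Y) s t)
        = vadd (lip_tensor p r X Y) (vscale (lip_tensor p r X Y) a s) (vscale (lip_tensor p r X Y) a t)"
      by (auto simp: distrib_left)
    show "vnorm (lip_tensor p r X Y) (vadd (lip_tensor p r X Y) s t)
        \<le> vnorm (lip_tensor p r X Y) s + vnorm (lip_tensor p r X Y) t"
      using d_Lip_triangle[OF s t] by (simp del: tensor_simps)
    show "vadd (lip_tensor p r X Y) (vadd (lip_tensor p r X Y) s t) z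
        = vadd (lip_tensor p r X Y) s (vadd (lip_tensor p r X Y) t z)"
      by (auto simp: add.assoc)
  }
  show "vzero (lip_tensor p r X Y) \<in> carr (lip_tensor p r X Y)"
    using tensor_zero_closed[of "snoc X Y"] by (simp del: tensor_simps)
qed

text \<open>The cost of the one-term representation \<open>(\<otimes>x - 0) \<otimes> y\<close>.\<close>

lemma d_Lip_tens_le:
  assumes x: "x \<in> tuples X" and y: "y \<in> carr Y"
  shows "d_Lip p r X Y (tens (snoc X Y) (snoc x y)) \<le> (\<Prod>i\<in>UNIV. vnorm (X i) (x i)) * vnorm Y y"
proof -
  let ?u = "\<lambda>_::nat. x" and ?v = "\<lambda>_::nat. zero_tuple" and ?y = "\<lambda>_::nat. y"
  have R: "tensor_rep X Y (tens (snoc X Y) (snoc x y)) 1 ?u ?v ?y"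
    using x y by (auto simp: tensor_rep_def zero_tuple_mem tens_def form_snoc_zero_tuple)
  have P: "0 \<le> (\<Prod>i\<in>UNIV. vnorm (X i) (x i))"
    by (intro prod_nonneg ballI seminormed_space.norm_nonneg[OF seminormed tuples_mem[OF x]])
  have W: "weak_lip_norm r X 1 ?u ?v \<le> (\<Prod>i\<in>UNIV. vnorm (X i) (x i))"
  proof (rule weak_lip_norm_least)
    fix \<phi> assume phi: "\<phi> \<in> unit_ball (bounded_forms X)"
    then have "\<phi> zero_tuple = 0" by (intro form_zero_tuple) (simp add: mem_bounded_forms_ball)
    then show "(\<Sum>i<1. norm (\<phi> (?u i) - \<phi> (?v i)) powr r) powr (1 / r) \<le> (\<Prod>i\<in>UNIV. vnorm (X i) (x i))"
      using form_bound[OF phi x] r_pos by (simp add: powr_powr)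
  qed
  have L: "lp_norm p 1 (\<lambda>i. vnorm Y (?y i)) \<le> vnorm Y y"
    using Y.norm_nonneg[OF y] p_gt_1 by (cases p) (auto simp: lp_norm_def powr_powr one_ereal_def)
  show ?thesis
    using d_Lip_upper[OF R] mult_mono[OF W L P lp_norm_nonneg] by linarith
qed

end

section \<open>Functionals on the tensor product and Lipschitz summing operators\<close>

context seminormed_family
begin

lemma forms_add_closed:
  assumes "\<phi> \<in> forms X" "\<psi> \<in> forms X"
  shows "(\<lambda>x\<in>tuples X. \<phi> x + \<psi> x) \<in> forms X"
  using assms seminormed_space.add_closed[OF seminormed] seminormed_space.scale_closed[OF seminormed]
  by (simp add: multilinear_def tuples_upd algebra_simps)

lemma forms_scale_closed:
  assumes "\<phi> \<in> forms X"
  shows "(\<lambda>x\<in>tuples X. a * \<phi> x) \<in> forms X"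
  using assms seminormed_space.add_closed[OF seminormed] seminormed_space.scale_closed[OF seminormed]
  by (simp add: multilinear_def tuples_upd algebra_simps)

end

text \<open>A tensor is itself linear on forms, which makes the correspondence below linear in \<open>T\<close>. The sum
  of the two forms enters as any form \<open>\<xi>\<close> with the right values.\<close>

lemma tensor_apply_add:
  assumes "z \<in> carr (tensor X)" and "\<phi> \<in> forms X" "\<psi> \<in> forms X" "\<xi> \<in> forms X"
    and "\<And>x. x \<in> tuples X \<Longrightarrow> \<xi> x = \<phi> x + \<psi> x"
  shows "z \<xi> = z \<phi> + z \<psi>"
  using assms(1)
  by (induction rule: tensor_induct)
    (simp_all add: tensor_simps tens_apply assms(2-) algebra_simps)

lemma tensor_apply_scale:
  assumes "z \<in> carr (tensor X)" and "\<phi> \<in> forms X" "\<xi> \<in> forms X"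
    and "\<And>x. x \<in> tuples X \<Longrightarrow> \<xi> x = a * \<phi> x"
  shows "z \<xi> = a * z \<phi>"
  using assms(1)
  by (induction rule: tensor_induct)
    (simp_all add: tensor_simps tens_apply assms(2-) algebra_simps)

lemma vsum_tensor_closed:
  "(\<And>i. i < k \<Longrightarrow> f i \<in> carr (tensor X)) \<Longrightarrow> vsum (tensor X) f k \<in> carr (tensor X)"
  by (induction k) (auto intro: tensor_zero_closed tensor_add_closed)

lemma tensor_rep_closed:
  assumes "tensor_rep X Y z k u v y"
  shows "z \<in> carr (tensor (snoc X Y))"
proof -
  have "z = vsum (tensor (snoc X Y)) (\<lambda>i. vdiff (tensor (snoc X Y))
      (tens (snoc X Y) (snoc (u i) (y i))) (tens (snoc X Y) (snoc (v i) (y i)))) k"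
    using assms by (auto simp: tensor_rep_def vsum_tensor tensor_simps tens_apply fun_eq_iff)
  also have "\<dots> \<in> carr (tensor (snoc X Y))"
    using assms by (intro vsum_tensor_closed tensor_diff_closed tens_closed snoc_mem_tuples)
      (auto simp: tensor_rep_def)
  finally show ?thesis .
qed

definition uncurry_form :: "('i::finite \<Rightarrow> ('k::{real_normed_field,banach}, 'a, 'm) vspace_scheme) \<Rightarrow>
    ('k, 'a, 'm) vspace_scheme \<Rightarrow> (('i \<Rightarrow> 'a) \<Rightarrow> 'a \<Rightarrow> 'k) \<Rightarrow> ('i option \<Rightarrow> 'a) \<Rightarrow> 'k" where
  "uncurry_form X Y T = (\<lambda>w\<in>tuples (snoc X Y). T (w \<circ> Some) (w None))"

definition tensor_functional :: "('i::finite \<Rightarrow> ('k::{real_normed_field,banach}, 'a, 'm) vspace_scheme) \<Rightarrow>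
    ('k, 'a, 'm) vspace_scheme \<Rightarrow> (('i \<Rightarrow> 'a) \<Rightarrow> 'a \<Rightarrow> 'k) \<Rightarrow> ((('i option \<Rightarrow> 'a) \<Rightarrow> 'k) \<Rightarrow> 'k) \<Rightarrow> 'k" where
  "tensor_functional X Y T = (\<lambda>z\<in>carr (tensor (snoc X Y)). z (uncurry_form X Y T))"

lemma uncurry_form_snoc:
  "x \<in> tuples X \<Longrightarrow> y \<in> carr Y \<Longrightarrow> uncurry_form X Y T (snoc x y) = T x y"
  by (simp add: uncurry_form_def snoc_mem_tuples o_def)

lemma lip_summing_simps:
  "vadd (lip_summing r X Z) S T = (\<lambda>x\<in>tuples X. vadd Z (S x) (T x))"
  "vscale (lip_summing r X Z) a T = (\<lambda>x\<in>tuples X. vscale Z a (T x))"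
  "vnorm (lip_summing r X Z) T = Inf {c. c > 0 \<and> lip_summing_bound r X Z T c}"
  by (simp_all add: lip_summing_def bounded_multilinear_def)

lemma mem_lip_summing_iff:
  "T \<in> carr (lip_summing r X Z) \<longleftrightarrow> T \<in> multilinear X Z \<and>
     (\<exists>C. \<forall>x\<in>tuples X. vnorm Z (T x) \<le> C * (\<Prod>i\<in>UNIV. vnorm (X i) (x i))) \<and>
     (\<exists>c>0. lip_summing_bound r X Z T c)"
  by (simp add: lip_summing_def bounded_multilinear_def)

lemma isometric_iso_compose:
  assumes f: "isometric_iso U V f" and g: "isometric_iso V W g"
  shows "isometric_iso U W (g \<circ> f)"
proof -
  have bf: "bij_betw f (carr U) (carr V)" and bg: "bij_betw g (carr V) (carr W)"
    using f g by (simp_all add: isometric_iso_def)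
  have "f x \<in> carr V" if "x \<in> carr U" for x
    using bij_betwE[OF bf] that by blast
  then show ?thesis
    using f g bij_betw_trans[OF bf bg] by (simp add: isometric_iso_def)
qed

context lip_tensor_product
begin

abbreviation "V \<equiv> lip_tensor p r X Y"

sublocale V: seminormed_space V by (rule seminormed_lip_tensor)

lemma seminormed_snoc: "seminormed_family (snoc X Y)"
  by (rule seminormed_family.intro) (simp add: seminormed seminormed_Y split: option.split)

sublocale XY: seminormed_family "snoc X Y" by (rule seminormed_snoc)

lemma multilinear_dual_mem: "T \<in> multilinear X (dual Y) \<Longrightarrow> x \<in> tuples X \<Longrightarrow> T x \<in> carr (dual Y)"
  by (rule multilinear_closed)

text \<open>Linearity in the last variable is that of the values of \<open>T\<close>, linearity in the others that of
  \<open>T\<close>.\<close>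

lemma uncurry_form_mem:
  assumes T: "T \<in> multilinear X (dual Y)"
  shows "uncurry_form X Y T \<in> forms (snoc X Y)"
proof -
  have D: "T x (vadd Y y y') = T x y + T x y'" "T x (vscale Y a y) = a * T x y"
    if "x \<in> tuples X" "y \<in> carr Y" "y' \<in> carr Y" for x y y' a
    using multilinear_dual_mem[OF T that(1)] that by (simp_all add: mem_dual_iff)
  have add: "uncurry_form X Y T (w(j := vadd (snoc X Y j) s t))
      = uncurry_form X Y T (w(j := s)) + uncurry_form X Y T (w(j := t))"
    if w: "w \<in> tuples (snoc X Y)" and s: "s \<in> carr (snoc X Y j)" and t: "t \<in> carr (snoc X Y j)" for w j s t
  proof -
    obtain x y where xy: "w = snoc x y" "x \<in> tuples X" "y \<in> carr Y" using w by (rule tuples_snocE)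
    show ?thesis
    proof (cases j)
      case None
      then show ?thesis
        using xy s t by (simp add: snoc_upd_None uncurry_form_snoc Y.add_closed D)
    next
      case (Some i)
      then show ?thesis
        using xy s t multilinear_add[OF T xy(2), of s i t]
        by (simp add: snoc_upd_Some uncurry_form_snoc tuples_upd dual_simps
            seminormed_space.add_closed[OF seminormed])
    qed
  qed
  have scale: "uncurry_form X Y T (w(j := vscale (snoc X Y j) a s))
      = a * uncurry_form X Y T (w(j := s))"
    if w: "w \<in> tuples (snoc X Y)" and s: "s \<in> carr (snoc X Y j)" for w j s a
  proof -
    obtain x y where xy: "w = snoc x y" "x \<in> tuples X" "y \<in> carr Y" using w by (rule tuples_snocE)
    show ?thesis
    proof (cases j)
      case None
      then show ?thesis
        using xy s by (simp add: snoc_upd_None uncurry_form_snoc Y.scale_closed D)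
    next
      case (Some i)
      then show ?thesis
        using xy s multilinear_scale[OF T xy(2), of s i a]
        by (simp add: snoc_upd_Some uncurry_form_snoc tuples_upd dual_simps
            seminormed_space.scale_closed[OF seminormed])
    qed
  qed
  have "uncurry_form X Y T \<in> extensional (tuples (snoc X Y))"
    by (simp add: uncurry_form_def)
  with add scale show ?thesis
    unfolding multilinear_def by simp
qed

lemma tensor_rep_uncurry:
  assumes T: "T \<in> multilinear X (dual Y)" and R: "tensor_rep X Y z k u v y"
  shows "z (uncurry_form X Y T) = (\<Sum>i<k. T (u i) (y i) - T (v i) (y i))"
  using R unfolding tensor_rep_apply[OF R uncurry_form_mem[OF T]]
  by (intro sum.cong refl) (simp add: tensor_rep_def uncurry_form_snoc)

text \<open>For each representation of \<open>z\<close>, Hoelder's inequality separates \<open>T(u\<^sub>i) - T(v\<^sub>i)\<close> from \<open>y\<^sub>i\<close>, and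
  the summing inequality bounds the first factor. Then take the infimum over all
  representations.\<close>

lemma tensor_functional_bound:
  assumes T: "T \<in> multilinear X (dual Y)" and c: "0 < c" and b: "lip_summing_bound r X (dual Y) T c"
    and z: "z \<in> carr (tensor (snoc X Y))"
  shows "norm (z (uncurry_form X Y T)) \<le> c * d_Lip p r X Y z"
proof -
  have "norm (z (uncurry_form X Y T)) / c \<le> d_Lip p r X Y z"
  proof (rule d_Lip_greatest[OF z])
    fix k u v y assume R: "tensor_rep X Y z k u v y"
    let ?D = "\<lambda>i. vdiff (dual Y) (T (u i)) (T (v i))"
    have mem: "u i \<in> tuples X" "v i \<in> tuples X" "y i \<in> carr Y" if "i < k" for i
      using R that by (auto simp: tensor_rep_def)
    have D: "?D i \<in> carr (dual Y)" "?D i (y i) = T (u i) (y i) - T (v i) (y i)" if "i < k" for i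
      using mem[OF that] Y.dual_diff_apply multilinear_dual_mem[OF T] by auto
    have "norm (z (uncurry_form X Y T)) \<le> (\<Sum>i<k. norm (T (u i) (y i) - T (v i) (y i)))"
      unfolding tensor_rep_uncurry[OF T R] by (rule norm_sum)
    also have "\<dots> \<le> (\<Sum>i<k. vnorm (dual Y) (?D i) * vnorm Y (y i))"
    proof (rule sum_mono)
      fix i assume "i \<in> {..<k}"
      then have i: "i < k" by simp
      show "norm (T (u i) (y i) - T (v i) (y i)) \<le> vnorm (dual Y) (?D i) * vnorm Y (y i)"
        using Y.dual_norm_bound[OF D(1)[OF i] mem(3)[OF i]] D(2)[OF i] by simp
    qed
    also have "\<dots> \<le> (\<Sum>i<k. vnorm (dual Y) (?D i) powr r) powr (1 / r) * lp_norm p k (\<lambda>i. vnorm Y (y i))"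
      by (intro lp_Hoelder[OF p_gt_1 conjugate] Y.dual_norm_nonneg Y.norm_nonneg mem D(1))
    also have "\<dots> \<le> (c * weak_lip_norm r X k u v) * lp_norm p k (\<lambda>i. vnorm Y (y i))"
      using b mem unfolding lip_summing_bound_def weak_lip_norm_def
      by (intro mult_right_mono lp_norm_nonneg) blast
    finally show "norm (z (uncurry_form X Y T)) / c
        \<le> weak_lip_norm r X k u v * lp_norm p k (\<lambda>i. vnorm Y (y i))"
      using c by (simp add: pos_divide_le_eq ac_simps)
  qed
  then show ?thesis using c by (simp add: pos_divide_le_eq mult.commute)
qed

text \<open>For fixed \<open>y\<^sub>i\<close> in the unit ball of \<open>Y\<close>, the inequality with \<open>(T(u\<^sub>i) - T(v\<^sub>i))(y\<^sub>i)\<close> in place of the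
  norm of \<open>T(u\<^sub>i) - T(v\<^sub>i)\<close> comes from one test tensor, in which \<open>y\<^sub>i\<close> is weighted so that Hoelder's
  inequality becomes an equality. Choosing the \<open>y\<^sub>i\<close> almost norming then gives the claim.\<close>

lemma lip_summing_bound_if:
  assumes T: "T \<in> multilinear X (dual Y)" and c: "0 \<le> c"
    and bound: "\<And>z. z \<in> carr (tensor (snoc X Y)) \<Longrightarrow> norm (z (uncurry_form X Y T)) \<le> c * d_Lip p r X Y z"
  shows "lip_summing_bound r X (dual Y) T c"
  unfolding lip_summing_bound_def weak_lip_norm_def[symmetric]
proof (intro allI impI)
  fix k :: nat and u v assume "\<forall>i<k. u i \<in> tuples X \<and> v i \<in> tuples X"
  then have uv: "\<And>i. i < k \<Longrightarrow> u i \<in> tuples X \<and> v i \<in> tuples X" by blast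
  have W: "0 \<le> weak_lip_norm r X k u v" by (rule weak_lip_norm_nonneg[OF r_pos uv])
  let ?D = "\<lambda>i. vdiff (dual Y) (T (u i)) (T (v i))"
  have D: "?D i \<in> carr (dual Y)" "y \<in> carr Y \<Longrightarrow> ?D i y = T (u i) y - T (v i) y" if "i < k" for i y
    using uv[OF that] Y.dual_diff_apply multilinear_dual_mem[OF T] by auto
  have test: "(\<Sum>i<k. norm (?D i (y i)) powr r) powr (1 / r) \<le> c * weak_lip_norm r X k u v"
    if y: "\<And>i. i < k \<Longrightarrow> y i \<in> unit_ball Y" for y
  proof -
    have yc: "y i \<in> carr Y" "vnorm Y (y i) \<le> 1" if "i < k" for i
      using y[OF that] by (auto simp: unit_ball_def)
    obtain b where b: "\<And>i. 0 \<le> b i" "lp_norm p k b \<le> 1"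
      "(\<Sum>i<k. b i * norm (?D i (y i))) = (\<Sum>i<k. norm (?D i (y i)) powr r) powr (1 / r)"
      by (rule lp_Hoelder_attained[OF p_gt_1 conjugate, of k "\<lambda>i. norm (?D i (y i))"]) auto
    \<comment> \<open>The quotient turns \<open>?D i (y i)\<close> into its absolute value. Where that is \<open>0\<close>, the
      quotient is \<open>0\<close> too.\<close>
    define s where "s i = of_real (b i) * (of_real (norm (?D i (y i))) / ?D i (y i))" for i
    have s: "s i * ?D i (y i) = of_real (b i * norm (?D i (y i)))" "norm (s i) \<le> b i" for i
      using b(1)[of i] by (auto simp: s_def norm_mult norm_divide)
    define z where "z = (\<lambda>\<psi>\<in>forms (snoc X Y).
      \<Sum>i<k. \<psi> (snoc (u i) (vscale Y (s i) (y i))) - \<psi> (snoc (v i) (vscale Y (s i) (y i))))"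
    have R: "tensor_rep X Y z k u v (\<lambda>i. vscale Y (s i) (y i))"
      using uv yc by (simp add: tensor_rep_def z_def Y.scale_closed)
    have "T (u i) (vscale Y (s i) (y i)) - T (v i) (vscale Y (s i) (y i))
        = of_real (b i * norm (?D i (y i)))" if i: "i < k" for i
    proof -
      have "T (u i) (vscale Y (s i) (y i)) - T (v i) (vscale Y (s i) (y i)) = s i * ?D i (y i)"
        using multilinear_dual_mem[OF T] uv[OF i] yc[OF i] D[OF i]
        by (simp add: mem_dual_iff right_diff_distrib)
      then show ?thesis by (simp only: s)
    qed
    then have "z (uncurry_form X Y T) = of_real (\<Sum>i<k. b i * norm (?D i (y i)))"
      unfolding tensor_rep_uncurry[OF T R] by simp
    then have "norm (z (uncurry_form X Y T)) = \<bar>\<Sum>i<k. b i * norm (?D i (y i))\<bar>"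
      by (simp only: norm_of_real)
    then have "(\<Sum>i<k. norm (?D i (y i)) powr r) powr (1 / r) = norm (z (uncurry_form X Y T))"
      unfolding b(3) by simp
    also have "\<dots> \<le> c * d_Lip p r X Y z"
      by (rule bound[OF tensor_rep_closed[OF R]])
    also have "\<dots> \<le> c * (weak_lip_norm r X k u v * lp_norm p k (\<lambda>i. vnorm Y (vscale Y (s i) (y i))))"
      by (rule mult_left_mono[OF d_Lip_upper[OF R] c])
    also have "\<dots> \<le> c * (weak_lip_norm r X k u v * 1)"
    proof (intro mult_left_mono c W)
      have "\<bar>vnorm Y (vscale Y (s i) (y i))\<bar> \<le> \<bar>b i\<bar>" if "i < k" for i
        using yc[OF that] s(2)[of i] mult_mono[OF s(2)[of i] yc(2)[OF that] b(1) Y.norm_nonneg[OF yc(1)[OF that]]]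
          Y.norm_nonneg[OF yc(1)[OF that]] b(1)[of i]
        by (simp add: Y.norm_scale)
      then have "lp_norm p k (\<lambda>i. vnorm Y (vscale Y (s i) (y i))) \<le> lp_norm p k b"
        by (rule lp_norm_mono[OF p_gt_1])
      then show "lp_norm p k (\<lambda>i. vnorm Y (vscale Y (s i) (y i))) \<le> 1"
        using b(2) by simp
    qed
    finally show ?thesis by simp
  qed
  show "(\<Sum>i<k. vnorm (dual Y) (?D i) powr r) powr (1 / r) \<le> c * weak_lip_norm r X k u v"
  proof (rule field_le_mult_one_interval)
    fix \<theta> :: real assume th: "0 < \<theta>" "\<theta> < 1"
    have "\<forall>i. \<exists>y. i < k \<longrightarrow> y \<in> unit_ball Y \<and> \<theta> * vnorm (dual Y) (?D i) \<le> norm (?D i y)"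
      using Y.dual_norm_approx[OF D(1) th] by blast
    then obtain y where y: "\<And>i. i < k \<Longrightarrow> y i \<in> unit_ball Y"
      "\<And>i. i < k \<Longrightarrow> \<theta> * vnorm (dual Y) (?D i) \<le> norm (?D i (y i))"
      by metis
    have "\<theta> * (\<Sum>i<k. vnorm (dual Y) (?D i) powr r) powr (1 / r)
        = (\<Sum>i<k. (\<theta> * vnorm (dual Y) (?D i)) powr r) powr (1 / r)"
      using th r_pos by (simp add: powr_mult powr_powr flip: sum_distrib_left)
    also have "\<dots> \<le> (\<Sum>i<k. norm (?D i (y i)) powr r) powr (1 / r)"
      using r_pos th y(2) Y.dual_norm_nonneg[OF D(1)]
      by (intro powr_mono2 sum_mono sum_nonneg) auto
    also have "\<dots> \<le> c * weak_lip_norm r X k u v"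
      by (rule test[OF y(1)])
    finally show "\<theta> * (\<Sum>i<k. vnorm (dual Y) (?D i) powr r) powr (1 / r) \<le> c * weak_lip_norm r X k u v" .
  qed
qed

lemma tensor_functional_mem:
  assumes T: "T \<in> carr (lip_summing r X (dual Y))"
  shows "tensor_functional X Y T \<in> carr (dual V)"
proof -
  have M: "T \<in> multilinear X (dual Y)" using T by (simp add: mem_lip_summing_iff)
  obtain c where "0 < c" "lip_summing_bound r X (dual Y) T c"
    using T by (auto simp: mem_lip_summing_iff)
  then have "\<exists>C. \<forall>z\<in>carr V. norm (tensor_functional X Y T z) \<le> C * vnorm V z"
    using tensor_functional_bound[OF M] by (intro exI[of _ c]) (simp add: tensor_functional_def)
  moreover have "tensor_functional X Y T \<in> extensional (carr V)"
    by (simp add: tensor_functional_def)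
  ultimately show ?thesis
    using V.add_closed V.scale_closed uncurry_form_mem[OF M]
    by (simp add: mem_dual_iff tensor_functional_def) (simp add: tensor_simps)
qed

lemma tensor_functional_tens:
  assumes "T \<in> multilinear X (dual Y)" "x \<in> tuples X" "y \<in> carr Y"
  shows "tensor_functional X Y T (tens (snoc X Y) (snoc x y)) = T x y"
  using assms by (simp add: tensor_functional_def tens_closed snoc_mem_tuples tens_apply
      uncurry_form_mem uncurry_form_snoc)

text \<open>The two previous bounds say that the admissible positive constants of \<open>T\<close> are exactly those at
  least the norm of the functional.\<close>

lemma vnorm_tensor_functional:
  assumes T: "T \<in> carr (lip_summing r X (dual Y))"
  shows "vnorm (dual V) (tensor_functional X Y T) = vnorm (lip_summing r X (dual Y)) T"
proof -
  let ?F = "tensor_functional X Y T"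
  let ?N = "vnorm (dual V) ?F"
  have M: "T \<in> multilinear X (dual Y)" using T by (simp add: mem_lip_summing_iff)
  have F: "?F \<in> carr (dual V)" by (rule tensor_functional_mem[OF T])
  have N: "0 \<le> ?N" by (rule V.dual_norm_nonneg[OF F])
  have iff: "lip_summing_bound r X (dual Y) T c \<longleftrightarrow> ?N \<le> c" if c: "0 < c" for c
  proof -
    have "?N \<le> c \<longleftrightarrow> (\<forall>z\<in>carr (tensor (snoc X Y)). norm (z (uncurry_form X Y T)) \<le> c * d_Lip p r X Y z)"
      using V.dual_norm_le_iff[OF F less_imp_le[OF c]] by (simp add: tensor_functional_def)
    then show ?thesis
      using tensor_functional_bound[OF M c] lip_summing_bound_if[OF M less_imp_le[OF c]] by blast
  qed
  have "Inf {c. c > 0 \<and> lip_summing_bound r X (dual Y) T c} = Inf {c. c > 0 \<and> ?N \<le> c}"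
    using iff by (metis (no_types, lifting))
  also have "\<dots> = ?N"
  proof (rule antisym)
    show "?N \<le> Inf {c. c > 0 \<and> ?N \<le> c}"
      using N by (intro cInf_greatest) (auto intro!: exI[of _ "?N + 1"])
    show "Inf {c. c > 0 \<and> ?N \<le> c} \<le> ?N"
    proof (rule field_le_epsilon)
      fix e :: real assume "0 < e"
      then show "Inf {c. c > 0 \<and> ?N \<le> c} \<le> ?N + e"
        using N by (intro cInf_lower) (auto intro!: bdd_belowI[of _ 0])
    qed
  qed
  finally show ?thesis by (simp add: lip_summing_simps)
qed

lemma lip_summing_eqI:
  assumes S: "S \<in> carr (lip_summing r X (dual Y))" and T: "T \<in> carr (lip_summing r X (dual Y))"
    and eq: "\<And>x y. x \<in> tuples X \<Longrightarrow> y \<in> carr Y \<Longrightarrow> S x y = T x y"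
  shows "S = T"
proof (rule extensionalityI[of _ "tuples X"])
  show "S \<in> extensional (tuples X)" "T \<in> extensional (tuples X)"
    using S T by (simp_all add: mem_lip_summing_iff multilinear_def)
  fix x assume x: "x \<in> tuples X"
  have "S x \<in> carr (dual Y)" "T x \<in> carr (dual Y)"
    using S T x multilinear_dual_mem by (auto simp: mem_lip_summing_iff)
  then show "S x = T x"
    using eq[OF x] by (intro extensionalityI[of _ "carr Y"]) (auto simp: mem_dual_iff)
qed

text \<open>\<open>T\<close> is the restriction of \<open>G\<close> to elementary tensors. It inherits multilinearity from the
  tensor product and boundedness from the norm of elementary tensors, and it induces \<open>G\<close> because
  elementary tensors span.\<close>

lemma tensor_functional_surj:
  assumes G: "G \<in> carr (dual V)"
  shows "\<exists>T\<in>carr (lip_summing r X (dual Y)). tensor_functional X Y T = G"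
proof -
  let ?t = "\<lambda>x y. tens (snoc X Y) (snoc x y)"
  define T where "T = (\<lambda>x\<in>tuples X. \<lambda>y\<in>carr Y. G (?t x y))"
  have t: "?t x y \<in> carr (tensor (snoc X Y))" if "x \<in> tuples X" "y \<in> carr Y" for x y
    using that by (intro tens_closed snoc_mem_tuples)
  have Gadd: "G (vadd (tensor (snoc X Y)) s s') = G s + G s'"
    if "s \<in> carr (tensor (snoc X Y))" "s' \<in> carr (tensor (snoc X Y))" for s s'
    using G that by (simp add: mem_dual_iff)
  have Gscale: "G (vscale (tensor (snoc X Y)) a s) = a * G s"
    if "s \<in> carr (tensor (snoc X Y))" for s a
    using G that by (simp add: mem_dual_iff)
  have t_add_last: "?t x (vadd Y y y') = vadd (tensor (snoc X Y)) (?t x y) (?t x y')"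
    if "x \<in> tuples X" "y \<in> carr Y" "y' \<in> carr Y" for x y y'
    using tens_upd_add[OF snoc_mem_tuples[OF that(1,2)], of y None y'] that
    by (simp add: snoc_upd_None)
  have t_scale_last: "?t x (vscale Y a y) = vscale (tensor (snoc X Y)) a (?t x y)"
    if "x \<in> tuples X" "y \<in> carr Y" for x y a
    using tens_upd_scale[OF snoc_mem_tuples[OF that], of y None a] that
    by (simp add: snoc_upd_None)
  have t_add: "?t (x(i := vadd (X i) a b)) y = vadd (tensor (snoc X Y)) (?t (x(i := a)) y) (?t (x(i := b)) y)"
    if "x \<in> tuples X" "a \<in> carr (X i)" "b \<in> carr (X i)" "y \<in> carr Y" for x i a b y
    using tens_upd_add[OF snoc_mem_tuples[OF that(1,4)], of a "Some i" b] that
    by (simp add: snoc_upd_Some)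
  have t_scale: "?t (x(i := vscale (X i) c a)) y = vscale (tensor (snoc X Y)) c (?t (x(i := a)) y)"
    if "x \<in> tuples X" "a \<in> carr (X i)" "y \<in> carr Y" for x i a c y
    using tens_upd_scale[OF snoc_mem_tuples[OF that(1,3)], of a "Some i" c] that
    by (simp add: snoc_upd_Some)
  let ?N = "vnorm (dual V) G"
  have N: "0 \<le> ?N" by (rule V.dual_norm_nonneg[OF G])
  have G_bound: "norm (G z) \<le> ?N * d_Lip p r X Y z" if "z \<in> carr (tensor (snoc X Y))" for z
    using V.dual_norm_bound[OF G, of z] that by simp
  have T_bound: "norm (T x y) \<le> (?N * (\<Prod>i\<in>UNIV. vnorm (X i) (x i))) * vnorm Y y"
    if "x \<in> tuples X" "y \<in> carr Y" for x y
    using G_bound[OF t[OF that]] mult_left_mono[OF d_Lip_tens_le[OF that] N] that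
    by (simp add: T_def mult.assoc)
  have T_dual: "T x \<in> carr (dual Y)" if x: "x \<in> tuples X" for x
    unfolding mem_dual_iff
  proof (intro conjI)
    show "\<exists>C. \<forall>y\<in>carr Y. norm (T x y) \<le> C * vnorm Y y"
      using T_bound[OF x] by blast
  qed (use x in \<open>simp_all add: T_def Y.add_closed Y.scale_closed t_add_last t_scale_last Gadd Gscale t\<close>)
  have M: "T \<in> multilinear X (dual Y)"
    unfolding multilinear_def
  proof (intro CollectI conjI ballI allI)
    show "T \<in> extensional (tuples X)" by (simp add: T_def)
    fix x assume x: "x \<in> tuples X"
    show "T x \<in> carr (dual Y)" by (rule T_dual[OF x])
    fix i a assume a: "a \<in> carr (X i)"
    show "T (x(i := vscale (X i) c a)) = vscale (dual Y) c (T (x(i := a)))" for c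
      using x a by (auto simp: T_def dual_simps tuples_upd seminormed_space.scale_closed[OF seminormed]
          t_scale Gscale t)
    fix b assume b: "b \<in> carr (X i)"
    show "T (x(i := vadd (X i) a b)) = vadd (dual Y) (T (x(i := a))) (T (x(i := b)))"
      using x a b by (auto simp: T_def dual_simps tuples_upd seminormed_space.add_closed[OF seminormed]
          t_add Gadd t)
  qed
  have FG: "z (uncurry_form X Y T) = G z" if "z \<in> carr (tensor (snoc X Y))" for z
    using that
  proof (induction rule: tensor_induct)
    case zero
    have "G (vzero (tensor (snoc X Y))) = 0"
      using V.dual_norm_bound[OF G V.zero_closed] V.norm_zero by simp
    moreover have "vzero (tensor (snoc X Y)) (uncurry_form X Y T) = 0"
      by (simp add: tensor_simps uncurry_form_mem[OF M])
    ultimately show ?case by simp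
  next
    case (add s c w)
    obtain x y where xy: "w = snoc x y" "x \<in> tuples X" "y \<in> carr Y" using add(2) by (rule tuples_snocE)
    have "uncurry_form X Y T w = G (tens (snoc X Y) w)"
      using xy by (simp add: uncurry_form_snoc T_def)
    then show ?case
      using add uncurry_form_mem[OF M]
      by (simp add: Gadd Gscale tensor_scale_closed tens_closed) (simp add: tensor_simps tens_apply)
  qed
  \<comment> \<open>The constant has to be positive, and the norm of \<open>G\<close> may be \<open>0\<close>.\<close>
  have summing: "lip_summing_bound r X (dual Y) T (?N + 1)"
  proof (rule lip_summing_bound_if[OF M])
    show "0 \<le> ?N + 1" using N by simp
    fix z assume z: "z \<in> carr (tensor (snoc X Y))"
    show "norm (z (uncurry_form X Y T)) \<le> (?N + 1) * d_Lip p r X Y z"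
      using G_bound[OF z] d_Lip_nonneg[OF z] by (simp add: FG[OF z] distrib_right)
  qed
  have bounded: "vnorm (dual Y) (T x) \<le> ?N * (\<Prod>i\<in>UNIV. vnorm (X i) (x i))" if x: "x \<in> tuples X" for x
    by (intro Y.dual_norm_le T_bound[OF x] mult_nonneg_nonneg N prod_nonneg ballI
        seminormed_space.norm_nonneg[OF seminormed tuples_mem[OF x]])
  have "0 < ?N + 1" using N by simp
  with M bounded summing have "T \<in> carr (lip_summing r X (dual Y))"
    unfolding mem_lip_summing_iff by blast
  moreover have "tensor_functional X Y T = G"
    using G FG by (intro extensionalityI[of _ "carr (tensor (snoc X Y))"])
      (auto simp: tensor_functional_def mem_dual_iff)
  ultimately show ?thesis by blast
qed

proposition isometric_iso_tensor_functional:
  "isometric_iso (lip_summing r X (dual Y)) (dual V) (tensor_functional X Y)"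
proof -
  let ?L = "lip_summing r X (dual Y)" and ?F = "tensor_functional X Y"
  have M: "T \<in> multilinear X (dual Y)" if "T \<in> carr ?L" for T
    using that by (simp add: mem_lip_summing_iff)
  have "bij_betw ?F (carr ?L) (carr (dual V))"
    unfolding bij_betw_def
  proof
    show "inj_on ?F (carr ?L)"
      using lip_summing_eqI tensor_functional_tens[OF M] by (intro inj_onI) metis
    show "?F ` carr ?L = carr (dual V)"
      using tensor_functional_mem tensor_functional_surj by blast
  qed
  moreover have "?F (vadd ?L S T) = vadd (dual V) (?F S) (?F T)"
    if S: "S \<in> carr ?L" and T: "T \<in> carr ?L" for S T
  proof -
    let ?\<psi> = "\<lambda>w\<in>tuples (snoc X Y). uncurry_form X Y S w + uncurry_form X Y T w"
    have eq: "uncurry_form X Y (vadd ?L S T) = ?\<psi>"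
    proof (rule extensionalityI[of _ "tuples (snoc X Y)"])
      fix w assume "w \<in> tuples (snoc X Y)"
      then obtain x y where xy: "w = snoc x y" "x \<in> tuples X" "y \<in> carr Y"
        by (rule tuples_snocE)
      then have "(vadd ?L S T) x y = S x y + T x y"
        by (simp add: lip_summing_simps dual_simps)
      with xy show "uncurry_form X Y (vadd ?L S T) w = ?\<psi> w"
        by (simp add: uncurry_form_snoc snoc_mem_tuples)
    qed (simp_all add: uncurry_form_def)
    have form: "?\<psi> \<in> forms (snoc X Y)"
      using S T M by (intro XY.forms_add_closed uncurry_form_mem)
    have "z ?\<psi> = z (uncurry_form X Y S) + z (uncurry_form X Y T)"
      if "z \<in> carr (tensor (snoc X Y))" for z
      using that by (rule tensor_apply_add) (use S T M form in \<open>simp_all add: uncurry_form_mem\<close>)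
    then show ?thesis
      unfolding tensor_functional_def eq by (auto simp: dual_simps)
  qed
  moreover have "?F (vscale ?L a T) = vscale (dual V) a (?F T)"
    if T: "T \<in> carr ?L" for a T
  proof -
    let ?\<psi> = "\<lambda>w\<in>tuples (snoc X Y). a * uncurry_form X Y T w"
    have eq: "uncurry_form X Y (vscale ?L a T) = ?\<psi>"
    proof (rule extensionalityI[of _ "tuples (snoc X Y)"])
      fix w assume "w \<in> tuples (snoc X Y)"
      then obtain x y where xy: "w = snoc x y" "x \<in> tuples X" "y \<in> carr Y"
        by (rule tuples_snocE)
      then have "(vscale ?L a T) x y = a * T x y"
        by (simp add: lip_summing_simps dual_simps)
      with xy show "uncurry_form X Y (vscale ?L a T) w = ?\<psi> w"
        by (simp add: uncurry_form_snoc snoc_mem_tuples)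
    qed (simp_all add: uncurry_form_def)
    have form: "?\<psi> \<in> forms (snoc X Y)"
      using T M by (intro XY.forms_scale_closed uncurry_form_mem)
    have "z ?\<psi> = a * z (uncurry_form X Y T)" if "z \<in> carr (tensor (snoc X Y))" for z
      using that by (rule tensor_apply_scale) (use T M form in \<open>simp_all add: uncurry_form_mem\<close>)
    then show ?thesis
      unfolding tensor_functional_def eq by (auto simp: dual_simps)
  qed
  ultimately show ?thesis
    unfolding isometric_iso_def using vnorm_tensor_functional by blast
qed

end

text \<open>The isomorphism is the composition of the two isometries above. A functional on the completion
  with the prescribed values at elementary tensors comes from some \<open>S\<close>, and those values
  determine \<open>S\<close>.\<close>

theorem theorem6p1:
  fixes X :: "'i::finite \<Rightarrow> ('k::{real_normed_field,banach}, 'a) nspace"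
    and Y :: "('k, 'a) nspace"
    and p :: ereal and p' :: real
  assumes "\<And>i. banach_space (X i)" and "banach_space Y"
    and "1 < p" and "1 / p + 1 / ereal p' = 1"
  shows "\<exists>\<Theta>.
    isometric_iso (lip_summing p' X (dual Y)) (dual (cauchy_completion (lip_tensor p p' X Y))) \<Theta> \<and>
    (\<forall>T\<in>carr (lip_summing p' X (dual Y)).
      \<forall>\<Phi>\<in>carr (dual (cauchy_completion (lip_tensor p p' X Y))).
        \<Theta> T = \<Phi> \<longleftrightarrow>
        (\<forall>x\<in>tuples X. \<forall>y\<in>carr Y.
           \<Phi> (to_completion (lip_tensor p p' X Y) (tens (snoc X Y) (snoc x y))) = T x y))"
proof -
  interpret lip_tensor_product X Y p p'
    using assms
    by (intro lip_tensor_product.intro seminormed_family.intro lip_tensor_product_axioms.intro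
        normed_space_imp_seminormed_space) (auto intro: banach_space.axioms)
  let ?L = "lip_summing p' X (dual Y)" and ?D = "dual (cauchy_completion V)"
  let ?\<Theta> = "extend_functional V \<circ> tensor_functional X Y"
  have iso: "isometric_iso ?L ?D ?\<Theta>"
    by (rule isometric_iso_compose[OF isometric_iso_tensor_functional V.isometric_iso_extend_functional])
  have on_tens: "?\<Theta> T (to_completion V (tens (snoc X Y) (snoc x y))) = T x y"
    if "T \<in> carr ?L" "x \<in> tuples X" "y \<in> carr Y" for T x y
    using that V.extend_functional_to_completion[OF tensor_functional_mem, of T]
    by (simp add: tensor_functional_tens mem_lip_summing_iff tens_closed snoc_mem_tuples)
  have "?\<Theta> T = \<Phi> \<longleftrightarrow> (\<forall>x\<in>tuples X. \<forall>y\<in>carr Y.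
      \<Phi> (to_completion V (tens (snoc X Y) (snoc x y))) = T x y)"
    if T: "T \<in> carr ?L" and Phi: "\<Phi> \<in> carr ?D" for T \<Phi>
  proof
    assume "\<forall>x\<in>tuples X. \<forall>y\<in>carr Y. \<Phi> (to_completion V (tens (snoc X Y) (snoc x y))) = T x y"
    moreover have "\<Phi> \<in> ?\<Theta> ` carr ?L"
      using iso Phi by (simp add: isometric_iso_def bij_betw_def)
    then obtain S where S: "\<Phi> = ?\<Theta> S" "S \<in> carr ?L" by (rule imageE)
    ultimately have "S = T"
      using on_tens[OF S(2)] by (intro lip_summing_eqI[OF S(2) T]) auto
    with S show "?\<Theta> T = \<Phi>" by simp
  qed (use on_tens[OF T] in auto)
  with iso show ?thesis by blast
qed

end
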